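(* Let $v_1,\dots,v_t\in\mathbb{R}^n$ be nonzero vectors with $\|v_i\|_2\le1$ for all $i$, let $\delta\in(0,1/2)$, and set $\sigma=\sqrt{\log(t/\delta)}$. Run $\textsc{PartialColoring}_\sigma(v_1,\dots,v_t)$ (described in the context). Then with probability at least $1-\delta$ we have $\|w_\ell-w_0\|_\infty\le 2\sqrt{2\log(t/\delta)\log(2nt/\delta)}$ for all $\ell\in[t]$. Furthermore, with probability at least $1-\delta$ we have $\|w_t-w_0\|_\infty\le 2\sqrt{2\log(t/\delta)\log(2n/\delta)}$. Finally, with probability at least $1-\delta$ all vectors are used, i.e. $J^{(i)}\neq0$ for every $i\in[t]$.
   Context: For $\sigma>0$ and $x\in\mathbb{R}$ let $p_\sigma(x)=\sum_{j\ge 1}(-1)^{j-1}\exp(-(j^2+2xj)/(2\sigma^2))$ and $r_\sigma(f)=\sum_{j\in\mathbb{Z}}(-1)^j\exp(-(j^2+2fj)/(2\sigma^2))$. Define the random variable $J^\sigma_x\in\{-1,0,1\}$ as follows: write $x=m+f$ with $m\in\mathbb{Z}$, $f\in[-1/2,1/2)$; if $m\ge1$, $J^\sigma_x=+1$ with probability $p_\sigma(m+f)$ and $-1$ otherwise; if $m\le -1$, $J^\sigma_x=-1$ with probability $p_\sigma(|m|-f)$ and $+1$ otherwise; if $m=0$, $J^\sigma_x=+1$ with probability $p_\sigma(f)$, $-1$ with probability $p_\sigma(-f)$, and $0$ with probability $r_\sigma(f)$. Algorithm $\textsc{PartialColoring}_\sigma(v_1,\dots,v_t)$: sample $w_0\sim\mathcal{N}(0,\sigma^2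 I_n)$; for $i=1,\dots,t$, set $\sigma'=\sigma/\|v_i\|_2$, $x'=\langle w_{i-1},v_i\rangle/\|v_i\|_2$, sample $J^{(i)}=J^{\sigma'}_{x'}$ (fresh independent randomness each step), and set $w_i=w_{i-1}+J^{(i)}v_i$. Thus $w_\ell-w_0=\sum_{i\le\ell}J^{(i)}v_i$.
   Formalization: In PartialColoring the coordinate x' is ⟨w_{i-1},v_i⟩/‖v_i‖₂² instead of the printed ⟨w_{i-1},v_i⟩/‖v_i‖₂; they agree for unit vectors, but with the printed form the second bound fails, e.g. n=1, all v_i=0.1, δ=0.1, t=60000. *)

theory Defs
  imports "HOL-Probability.Probability"
begin

definition up_prob :: "real \<Rightarrow> real \<Rightarrow> real" where
  "up_prob \<sigma> x =
     (\<Sum>\<^sub>\<infinity>j\<in>{1::nat..}. (-1) ^ (j - 1) * exp (- ((real j)\<^sup>2 + 2 * x * real j) / (2 * \<sigma>\<^sup>2)))"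

definition rest_prob :: "real \<Rightarrow> real \<Rightarrow> real" where
  "rest_prob \<sigma> f =
     (\<Sum>\<^sub>\<infinity>j\<in>(UNIV :: int set). (-1) powi j * exp (- ((real_of_int j)\<^sup>2 + 2 * f * real_of_int j) / (2 * \<sigma>\<^sup>2)))"

text \<open>
  The decomposition \<open>x = m + f\<close> with \<open>f\<close> in \<open>[-1/2, 1/2)\<close> is given by \<open>m = round x\<close>, as
  \<open>round x\<close> is the floor of \<open>x + 1/2\<close>.
\<close>

definition step_prob :: "real \<Rightarrow> real \<Rightarrow> int \<Rightarrow> real" where
  "step_prob \<sigma> x k =
     (let m = round x; f = x - real_of_int m in
      if m \<ge> 1 then
        (if k = 1 then up_prob \<sigma> (real_of_int m + f)
         else if k = -1 then 1 - up_prob \<sigma> (real_of_int m + f)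
         else 0)
      else if m \<le> -1 then
        (if k = -1 then up_prob \<sigma> (real_of_int \<bar>m\<bar> - f)
         else if k = 1 then 1 - up_prob \<sigma> (real_of_int \<bar>m\<bar> - f)
         else 0)
      else
        (if k = 1 then up_prob \<sigma> f
         else if k = -1 then up_prob \<sigma> (- f)
         else if k = 0 then rest_prob \<sigma> f
         else 0))"

text \<open>
  For \<open>\<sigma> > 0\<close> the weights \<open>step_prob \<sigma> x\<close> are nonnegative and sum to one, so that
  \<open>embed_pmf\<close> yields the distribution with exactly these weights. The only delicate point is
  \<open>rest_prob \<sigma> f \<ge> 0\<close> for \<open>\<bar>f\<bar> \<le> 1/2\<close>, which follows from the Jacobi triple product.
\<close>

definition step_pmf :: "real \<Rightarrow> real \<Rightarrow> int pmf" where
  "step_pmf \<sigma> x = embed_pmf (step_prob \<sigma> x)"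

text \<open>The normal distribution with mean \<open>0\<close> and covariance matrix \<open>\<sigma>\<^sup>2 I\<close>, by its density.\<close>

definition isotropic_gaussian :: "real \<Rightarrow> (real ^ 'n) measure" where
  "isotropic_gaussian \<sigma> = density lborel (\<lambda>w. ennreal (\<Prod>i\<in>UNIV. normal_density 0 \<sigma> (w $ i)))"

text \<open>
  Lists are indexed from \<open>0\<close>: the vector \<open>v\<^sub>i\<close> is \<open>vs ! (i - 1)\<close> and the step \<open>J\<close> taken with it
  is \<open>js ! (i - 1)\<close>. Then \<open>walk w\<^sub>0 vs js i\<close> is \<open>w\<^sub>i\<close>.
\<close>

primrec walk :: "real ^ 'n \<Rightarrow> (real ^ 'n) list \<Rightarrow> int list \<Rightarrow> nat \<Rightarrow> real ^ 'n" where
  "walk w0 vs js 0 = w0"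
| "walk w0 vs js (Suc i) = walk w0 vs js i + real_of_int (js ! i) *\<^sub>R (vs ! i)"

text \<open>
  The joint distribution of the first \<open>i\<close> steps, given the starting point. The position along \<open>v\<close>
  is measured in units of the step length \<open>norm v\<close>, so it is the inner product with \<open>v\<close> divided by
  \<open>(norm v)\<^sup>2\<close>: if \<open>w\<close> has variance \<open>\<sigma>\<^sup>2\<close> in every direction, this coordinate has standard
  deviation \<open>\<sigma> / norm v\<close>, and adding \<open>k *\<^sub>R v\<close> to \<open>w\<close> shifts it by \<open>k\<close>.
\<close>

primrec steps_pmf :: "real \<Rightarrow> (real ^ 'n) list \<Rightarrow> real ^ 'n \<Rightarrow> nat \<Rightarrow> int list pmf" where
  "steps_pmf \<sigma> vs w0 0 = return_pmf []"
| "steps_pmf \<sigma> vs w0 (Suc i) =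
     do {
       js \<leftarrow> steps_pmf \<sigma> vs w0 i;
       k \<leftarrow> step_pmf (\<sigma> / norm (vs ! i)) ((walk w0 vs js i \<bullet> (vs ! i)) / (norm (vs ! i))\<^sup>2);
       return_pmf (js @ [k])
     }"

text \<open>The joint distribution of the starting point and of all steps in a run of the algorithm.\<close>

definition partial_coloring :: "real \<Rightarrow> (real ^ 'n) list \<Rightarrow> ((real ^ 'n) \<times> int list) measure" where
  "partial_coloring \<sigma> vs =
     do {
       w0 \<leftarrow> isotropic_gaussian \<sigma>;
       js \<leftarrow> measure_pmf (steps_pmf \<sigma> vs w0 (length vs));
       return (borel \<Otimes>\<^sub>M count_space UNIV) (w0, js)
     }"

end

theory Submission
  imports Defs
begin

text \<open>
  If \<open>X\<close> is centred normal with variance \<open>\<sigma>\<^sup>2\<close>, then so is \<open>X + J\<close>, where \<open>J\<close> is the random step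
  at \<open>X\<close>: with \<open>\<phi>\<close> the Gaussian weight, \<open>\<phi>(x) p\<^sub>\<sigma>(x)\<close> is the alternating series
  \<open>\<phi>(x + 1) - \<phi>(x + 2) + \<dots>\<close>, so the mass arriving at a point telescopes to \<open>\<phi>\<close>. Hence every \<open>w\<^sub>i\<close> is
  distributed as \<open>w\<^sub>0\<close>, a coordinate of \<open>w\<^sub>i - w\<^sub>0\<close> is a difference of two (dependent) normal variables,
  and by convexity its exponential moment at \<open>\<lambda>\<close> is at most that of a single one at \<open>2 \<lambda>\<close>; the
  displacement bounds follow by Markov's inequality and a union bound.

  A zero step at \<open>x\<close> has probability at most \<open>r\<^sub>\<sigma>(x)\<close>. The Jacobi triple product writes it, with
  \<open>q = exp (- 1 / (2 \<sigma>\<^sup>2))\<close>, as a product of nonnegative factors, which gives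
  \<open>0 \<le> r\<^sub>\<sigma>(x) \<le> exp (- (q\<^sup>2 + 2 q) / (1 - q\<^sup>2)) \<le> exp (- \<sigma>\<^sup>2)\<close> as soon as \<open>\<sigma>\<^sup>2 \<ge> 1/2\<close>; the last
  bound is \<open>\<delta> / t\<close>.
\<close>

section \<open>The Jacobi triple product\<close>

text \<open>The q-Pochhammer symbol (p; p)_n.\<close>

definition qpoch :: "real \<Rightarrow> nat \<Rightarrow> real" where
  "qpoch p n = (\<Prod>i<n. 1 - p ^ Suc i)"

text \<open>Reciprocals get the value 0 at negative arguments, the usual convention for 1 / (p;
  p)_k. The recurrence below then also holds at k = -1, where the factor 1 - p^0 vanishes.\<close>

definition qpoch_inv :: "real \<Rightarrow> int \<Rightarrow> real" where
  "qpoch_inv p k = (if k < 0 then 0 else 1 / qpoch p (nat k))"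

lemma qpoch_pos: "0 < p \<Longrightarrow> p < 1 \<Longrightarrow> 0 < qpoch p n"
  unfolding qpoch_def by (intro prod_pos) (auto simp del: power_Suc simp: power_Suc_less_one)

lemma qpoch_inv_rec:
  assumes "0 < p" "p < 1"
  shows "qpoch_inv p k = (1 - p powi (k + 1)) * qpoch_inv p (k + 1)"
proof -
  consider "k < -1" | "k = -1" | "0 \<le> k" by linarith
  then show ?thesis
  proof cases
    case 3
    then obtain n where k: "k = int n" by (rule nonneg_int_cases)
    have "nat (int n + 1) = Suc n" by simp
    moreover have "p powi (int n + 1) = p ^ Suc n"
      by (metis power_int_of_nat of_nat_Suc add.commute)
    moreover have "p ^ Suc n < 1" using assms power_Suc_less_one by blast
    ultimately show ?thesis using k by (simp add: qpoch_inv_def qpoch_def del: power_Suc)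
  qed (auto simp: qpoch_inv_def)
qed

definition triple_coeff :: "real \<Rightarrow> nat \<Rightarrow> int \<Rightarrow> real" where
  "triple_coeff p n j = qpoch p (2 * n) * qpoch_inv p (int n - j) * qpoch_inv p (int n + j)"

text \<open>Two applications of the q-Pascal rule, as the upper index 2n grows by two. With p = q^2
  the three terms mirror multiplication of the finite product by its next factor 1 + a^2 - a z - a /
  z, where a = q^(2n+1).\<close>

lemma triple_coeff_Suc:
  assumes "0 < p" "p < 1"
  shows "triple_coeff p (Suc n) j = (1 + p ^ (2 * n + 1)) * triple_coeff p n j
     + p powi (int n + 1 - j) * triple_coeff p n (j - 1)
     + p powi (int n + 1 + j) * triple_coeff p n (j + 1)"
proof -
  \<comment> \<open>\<open>b\<close> and \<open>b'\<close> have the largest arguments that occur, so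
    every other reciprocal is a polynomial multiple of one of them. What remains is a polynomial
    identity in p, u and w.\<close>
  define b b' where "b = qpoch_inv p (int n + 1 - j)" and "b' = qpoch_inv p (int n + 1 + j)"
  define u w where "u = p powi (int n - j)" and "w = p powi (int n + j)"
  have uw: "p ^ (2 * n) = u * w"
    using assms unfolding u_def w_def by (simp flip: power_int_add) (simp flip: power_int_of_nat)
  have pu: "p powi (int n + 1 - j) = p * u" "p powi (int n + 1 + j) = p * w"
    using assms unfolding u_def w_def by (simp_all flip: power_int_add_1' add: algebra_simps)
  have e1: "qpoch_inv p (int n - j) = (1 - p * u) * b"
    using qpoch_inv_rec[OF assms, of "int n - j"] pu by (simp add: b_def algebra_simps)
  have e2: "qpoch_inv p (int n + j) = (1 - p * w) * b'"
    using qpoch_inv_rec[OF assms, of "int n + j"] pu by (simp add: b'_def algebra_simps)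
  have e3: "qpoch_inv p (int n - j - 1) = (1 - u) * ((1 - p * u) * b)"
    using qpoch_inv_rec[OF assms, of "int n - j - 1"] e1 by (simp add: u_def)
  have e4: "qpoch_inv p (int n + j - 1) = (1 - w) * ((1 - p * w) * b')"
    using qpoch_inv_rec[OF assms, of "int n + j - 1"] e2 by (simp add: w_def)
  have q: "qpoch p (2 * Suc n) = qpoch p (2 * n) * (1 - p * (u * w)) * (1 - p * (p * (u * w)))"
    unfolding uw[symmetric] by (simp add: qpoch_def)
  have t0: "triple_coeff p n j = qpoch p (2 * n) * ((1 - p * u) * b) * ((1 - p * w) * b')"
    by (simp add: triple_coeff_def e1 e2)
  have t1: "triple_coeff p n (j - 1) = qpoch p (2 * n) * b * ((1 - w) * ((1 - p * w) * b'))"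
    using e4 by (simp add: triple_coeff_def b_def diff_diff_eq2 add_diff_eq)
  have t2: "triple_coeff p n (j + 1) = qpoch p (2 * n) * ((1 - u) * ((1 - p * u) * b)) * b'"
    using e3 by (simp add: triple_coeff_def b'_def diff_diff_eq add.assoc add.commute[of 1])
  have t3: "triple_coeff p (Suc n) j = qpoch p (2 * Suc n) * b * b'"
    by (simp add: triple_coeff_def b_def b'_def add.commute[of 1])
  show ?thesis
    unfolding t0 t1 t2 t3 q pu power_add uw by (simp add: algebra_simps)
qed

text \<open>
  The coefficient of the finite triple product is the Gaussian binomial coefficient of \<open>2n\<close> over
  \<open>n + j\<close> in the variable \<open>p\<close>; as \<open>qpoch_inv\<close> vanishes at negative arguments, the recurrence above
  holds for all integers \<open>j\<close>.
\<close>

lemma finite_triple_product: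
  fixes q z :: real
  assumes q: "0 < q" "q < 1" and z: "0 < z"
  shows "((\<lambda>j. (-1) powi j * triple_coeff (q\<^sup>2) n j * (q powi (j * j) * z powi j)) has_sum
      (\<Prod>k<n. (1 - z * q ^ (2 * k + 1)) * (1 - q ^ (2 * k + 1) / z))) UNIV"
proof (induction n)
  case 0
  \<comment> \<open>For n = 0 and j \<noteq> 0 one of the arguments -j and j is negative, so only
    the term at j = 0 survives.\<close>
  show ?case
    by (rule has_sum_finite_neutralI[of "{0}"])
      (auto simp: triple_coeff_def qpoch_inv_def qpoch_def)
next
  case (Suc n)
  have p: "0 < q\<^sup>2" "q\<^sup>2 < 1" using q by (auto simp: power_less_one_iff)
  define g where "g n j = (-1) powi j * triple_coeff (q\<^sup>2) n j * (q powi (j * j) * z powi j)"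
    for n and j :: int
  define S where "S = (\<Prod>k<n. (1 - z * q ^ (2 * k + 1)) * (1 - q ^ (2 * k + 1) / z))"
  define a where "a = q ^ (2 * n + 1)"
  have aq: "a = q powi (2 * int n + 1)"
  proof -
    have "2 * int n + 1 = int (2 * n + 1)" by simp
    then show ?thesis unfolding a_def by (simp only: power_int_of_nat)
  qed
  have pq: "(q\<^sup>2) powi k = q powi (2 * k)" for k
    unfolding power_int_mult by simp
  have qadd: "q powi k * q powi l = q powi (k + l)" for k l
    using q by (simp add: power_int_add)
  have 1: "(g n has_sum S) UNIV"
    using Suc unfolding g_def S_def .
  have 2: "((\<lambda>j. g n (j - 1)) has_sum S) UNIV"
    using 1 has_sum_reindex_bij_witness[of UNIV "\<lambda>j. j + 1" "\<lambda>j. j - 1" UNIV "g n" "\<lambda>j. g n (j - 1)" S S]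
    by simp
  have 3: "((\<lambda>j. g n (j + 1)) has_sum S) UNIV"
    using 1 has_sum_reindex_bij_witness[of UNIV "\<lambda>j. j - 1" "\<lambda>j. j + 1" UNIV "g n" "\<lambda>j. g n (j + 1)" S S]
    by simp
  \<comment> \<open>The new factor (1 - z a)(1 - a / z) is expanded; each term in z or 1 / z is
    paired with the series shifted by one, so that equal powers of z meet.\<close>
  have "((\<lambda>j. (1 + a\<^sup>2) * g n j + (- a * z) * g n (j - 1) + (- a / z) * g n (j + 1))
      has_sum ((1 + a\<^sup>2) * S + (- a * z) * S + (- a / z) * S)) UNIV"
    by (intro has_sum_add has_sum_cmult_right 1 2 3)
  moreover have "(1 + a\<^sup>2) * S + (- a * z) * S + (- a / z) * S = S * ((1 - z * a) * (1 - a / z))"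
    using z by (simp add: field_simps power2_eq_square)
  moreover have "(1 + a\<^sup>2) * g n j + (- a * z) * g n (j - 1) + (- a / z) * g n (j + 1) = g (Suc n) j" for j
  proof -
    define c where "c = (-1) powi j * (q powi (j * j) * z powi j)"
    have s: "(-1) powi (j - 1) = - ((-1) powi j :: real)" "(-1) powi (j + 1) = - ((-1) powi j :: real)"
      by (simp_all add: power_int_minus_left)
    have zz: "z powi (j - 1) = z powi j / z" "z powi (j + 1) = z powi j * z"
      using z by (simp_all add: power_int_diff power_int_add)
    \<comment> \<open>Exponents: (2n + 1) + (j - 1)^2 = 2 (n + 1 - j) + j^2, and likewise with -j
      for j in \<open>m2\<close>.\<close>
    have m1: "a * q powi ((j - 1) * (j - 1)) = (q\<^sup>2) powi (int n + 1 - j) * q powi (j * j)"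
      unfolding aq pq qadd by (rule arg_cong[of _ _ "power_int q"]) (simp add: algebra_simps)
    have m2: "a * q powi ((j + 1) * (j + 1)) = (q\<^sup>2) powi (int n + 1 + j) * q powi (j * j)"
      unfolding aq pq qadd by (rule arg_cong[of _ _ "power_int q"]) (simp add: algebra_simps)
    have "(- a * z) * g n (j - 1) = (-1) powi j * z powi j * triple_coeff (q\<^sup>2) n (j - 1) * (a * q powi ((j - 1) * (j - 1)))"
      using z by (simp add: g_def s zz)
    also have "\<dots> = c * ((q\<^sup>2) powi (int n + 1 - j) * triple_coeff (q\<^sup>2) n (j - 1))"
      unfolding m1 by (simp add: c_def)
    finally have g1: "(- a * z) * g n (j - 1) = \<dots>" .
    have "(- a / z) * g n (j + 1) = (-1) powi j * z powi j * triple_coeff (q\<^sup>2) n (j + 1) * (a * q powi ((j + 1) * (j + 1)))"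
      using z by (simp add: g_def s zz)
    also have "\<dots> = c * ((q\<^sup>2) powi (int n + 1 + j) * triple_coeff (q\<^sup>2) n (j + 1))"
      unfolding m2 by (simp add: c_def)
    finally have g2: "(- a / z) * g n (j + 1) = \<dots>" .
    have "a\<^sup>2 = (q\<^sup>2) ^ (2 * n + 1)" by (simp only: a_def mult.commute flip: power_mult)
    then have g0: "(1 + a\<^sup>2) * g n j = c * ((1 + (q\<^sup>2) ^ (2 * n + 1)) * triple_coeff (q\<^sup>2) n j)"
      by (simp add: g_def c_def)
    have "g (Suc n) j = c * triple_coeff (q\<^sup>2) (Suc n) j" by (simp add: g_def c_def)
    then show ?thesis unfolding g0 g1 g2 triple_coeff_Suc[OF p] by (simp only: ring_distribs)
  qed
  ultimately have "(g (Suc n) has_sum S * ((1 - z * a) * (1 - a / z))) UNIV" by simp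
  then show ?case unfolding g_def S_def a_def by (simp only: prod.lessThan_Suc)
qed

text \<open>The factors lie in (0, 1), so the sequence decreases to its limit; summability of p^i
  makes the infinite product converge to a nonzero value. The lower bound L later bounds all
  reciprocals uniformly by 1 / L.\<close>

lemma qpoch_limit:
  assumes "0 < p" "p < 1"
  obtains L where "0 < L" "qpoch p \<longlonglongrightarrow> L" "\<And>n. L \<le> qpoch p n"
proof -
  have "abs_convergent_prod (\<lambda>i. 1 - p ^ Suc i)"
    using assms summable_geometric[of p]
    by (intro summable_imp_abs_convergent_prod) (simp add: abs_mult summable_mult)
  then have c: "convergent_prod (\<lambda>i. 1 - p ^ Suc i)" by (rule abs_convergent_prod_imp_convergent_prod)
  define L where "L = prodinf (\<lambda>i. 1 - p ^ Suc i)"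
  have f: "0 < 1 - p ^ Suc i" "1 - p ^ Suc i \<le> 1" for i
    using assms power_Suc_less_one[of p i] by (auto simp del: power_Suc)
  have "(\<lambda>n. qpoch p (Suc n)) \<longlonglongrightarrow> L"
    unfolding qpoch_def L_def lessThan_Suc_atMost by (rule convergent_prod_LIMSEQ[OF c])
  then have lim: "qpoch p \<longlonglongrightarrow> L" by (rule LIMSEQ_imp_Suc)
  have L0: "L \<noteq> 0" unfolding L_def using f by (subst prodinf_nonzero[OF c]) (auto simp: less_le)
  have "decseq (qpoch p)" unfolding decseq_Suc_iff qpoch_def
    unfolding prod.lessThan_Suc using f by (intro allI mult_left_le prod_nonneg) (auto intro: less_imp_le)
  then have Lle: "L \<le> qpoch p n" for n using lim by (rule decseq_ge)
  have "0 \<le> L"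
    using qpoch_pos[OF assms] by (intro LIMSEQ_le_const[OF lim]) (auto intro: less_imp_le)
  with L0 have "0 < L" by simp
  then show ?thesis by (rule that[OF _ lim Lle])
qed

section \<open>Passage to the infinite product\<close>

lemma summable_gauss:
  fixes \<sigma> x :: real
  assumes "0 < \<sigma>"
  shows "summable (\<lambda>k::nat. exp (- ((real k)\<^sup>2 + 2 * x * real k) / (2 * \<sigma>\<^sup>2)))"
proof (rule summable_comparison_test')
  have "exp (- 1 / \<sigma>\<^sup>2) < 1" using assms by simp
  then show "summable (\<lambda>k. exp ((1 - x)\<^sup>2 / (2 * \<sigma>\<^sup>2)) * exp (- 1 / \<sigma>\<^sup>2) ^ k)"
    by (intro summable_mult summable_geometric) simp
next
  fix k :: nat
  \<comment> \<open>This square bounds the quadratic exponent by a linear one, which gives a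
    geometric majorant of ratio exp (-1 / \<sigma>^2).\<close>
  have "0 \<le> (real k - (1 - x))\<^sup>2" by simp
  then have "- ((real k)\<^sup>2 + 2 * x * real k) \<le> (1 - x)\<^sup>2 + - 2 * real k"
    by (simp add: power2_eq_square algebra_simps)
  then have "- ((real k)\<^sup>2 + 2 * x * real k) / (2 * \<sigma>\<^sup>2) \<le> ((1 - x)\<^sup>2 + - 2 * real k) / (2 * \<sigma>\<^sup>2)"
    by (intro divide_right_mono) auto
  also have "\<dots> = (1 - x)\<^sup>2 / (2 * \<sigma>\<^sup>2) + real k * (- 1 / \<sigma>\<^sup>2)"
    using assms by (simp add: field_simps)
  finally have "exp (- ((real k)\<^sup>2 + 2 * x * real k) / (2 * \<sigma>\<^sup>2))
      \<le> exp ((1 - x)\<^sup>2 / (2 * \<sigma>\<^sup>2) + real k * (- 1 / \<sigma>\<^sup>2))"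
    by simp
  also have "\<dots> = exp ((1 - x)\<^sup>2 / (2 * \<sigma>\<^sup>2)) * exp (- 1 / \<sigma>\<^sup>2) ^ k"
    unfolding exp_add exp_of_nat_mult ..
  finally show "norm (exp (- ((real k)\<^sup>2 + 2 * x * real k) / (2 * \<sigma>\<^sup>2)))
      \<le> exp ((1 - x)\<^sup>2 / (2 * \<sigma>\<^sup>2)) * exp (- 1 / \<sigma>\<^sup>2) ^ k" by simp
qed

lemma summable_on_gauss_int:
  fixes \<sigma> x :: real
  assumes "0 < \<sigma>"
  shows "(\<lambda>j::int. exp (- ((of_int j)\<^sup>2 + 2 * x * of_int j) / (2 * \<sigma>\<^sup>2))) summable_on UNIV"
    (is "?e summable_on _")
proof -
  have "?e summable_on range int" "?e summable_on range (\<lambda>k. - int k)"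
    using summable_nonneg_imp_summable_on[OF summable_gauss[OF assms, of x]]
      summable_nonneg_imp_summable_on[OF summable_gauss[OF assms, of "- x"]]
    by (subst summable_on_reindex; simp add: inj_on_def o_def)+
  then have "?e summable_on (range int \<union> range (\<lambda>k. - int k))"
    by (rule summable_on_union)
  moreover have "j \<in> range int \<union> range (\<lambda>k. - int k)" for j :: int
    by (cases j rule: int_cases2) auto
  then have "range int \<union> range (\<lambda>k. - int k) = UNIV" by blast
  ultimately show ?thesis by simp
qed

text \<open>Dominated convergence for the counting measure, reached through
  \<open>infsetsum\<close>, which is an integral by definition.\<close>

lemma infsum_dominated_convergence:
  fixes u :: "nat \<Rightarrow> 'a \<Rightarrow> real"
  assumes lim: "\<And>j. (\<lambda>n. u n j) \<longlonglongrightarrow> f j" and w: "w summable_on UNIV"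
    and le: "\<And>n j. \<bar>u n j\<bar> \<le> w j"
  shows "(\<lambda>n. infsum (u n) UNIV) \<longlonglongrightarrow> infsum f UNIV"
proof -
  have "\<bar>f j\<bar> \<le> w j" for j
    using le by (intro LIMSEQ_le_const2[OF tendsto_rabs[OF lim]]) auto
  then have f: "(\<lambda>j. norm (f j)) summable_on UNIV"
    by (intro summable_on_comparison_test[OF w]) auto
  have u: "(\<lambda>j. norm (u n j)) summable_on UNIV" for n
    using le by (intro summable_on_comparison_test[OF w]) auto
  have "(\<lambda>j. norm (w j)) = w"
    using order_trans[OF abs_ge_zero le] by (auto simp: abs_of_nonneg)
  then have "Infinite_Set_Sum.abs_summable_on w UNIV"
    using w unfolding abs_summable_equivalent[symmetric] by simp
  then have "integrable (count_space UNIV) w"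
    by (simp add: Infinite_Set_Sum.abs_summable_on_def)
  then have "(\<lambda>n. infsetsum (u n) UNIV) \<longlonglongrightarrow> infsetsum f UNIV"
    unfolding infsetsum_def
    by (intro integral_dominated_convergence[where w = w]) (use lim le in auto)
  then show ?thesis
    unfolding infsetsum_infsum[OF f[unfolded abs_summable_equivalent]]
      infsetsum_infsum[OF u[unfolded abs_summable_equivalent]] .
qed

text \<open>The finite identity is multiplied by \<open>qpoch (q\<^sup>2) n\<close>. The coefficient
  of the j-th term then tends to L * L * (1 / L) * (1 / L) = 1 and is bounded by 1 / L^2 throughout,
  so dominated convergence applies with the theta series as majorant.\<close>

lemma jacobi_triple_product_limit:
  fixes q z :: real
  assumes q: "0 < q" "q < 1" and z: "0 < z"
    and sum: "(\<lambda>j. q powi (j * j) * z powi j) summable_on UNIV"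
  shows "(\<lambda>n. (\<Prod>k<n. (1 - (q\<^sup>2) ^ Suc k) * ((1 - z * q ^ (2 * k + 1)) * (1 - q ^ (2 * k + 1) / z))))
    \<longlonglongrightarrow> (\<Sum>\<^sub>\<infinity>j\<in>UNIV. (-1) powi j * (q powi (j * j) * z powi j))"
proof -
  let ?p = "q\<^sup>2"
  have p: "0 < ?p" "?p < 1" using q by (auto simp: power_less_one_iff)
  obtain L where L: "0 < L" "qpoch ?p \<longlonglongrightarrow> L" "\<And>n. L \<le> qpoch ?p n"
    using qpoch_limit[OF p] by blast
  define g where "g n j = (-1) powi j * (qpoch ?p n * triple_coeff ?p n j) * (q powi (j * j) * z powi j)"
    for n j
  have le1: "qpoch ?p n \<le> 1" for n
    using p unfolding qpoch_def by (intro prod_le_1) (auto simp: mult_le_one power_le_one)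
  have inv: "0 \<le> qpoch_inv ?p k" "qpoch_inv ?p k \<le> 1 / L" for k
    using L(1) L(3)[of "nat k"] qpoch_pos[OF p, of "nat k"]
    by (auto simp: qpoch_inv_def frac_le)
  have bound: "\<bar>g n j\<bar> \<le> 1 / L * (1 / L) * (q powi (j * j) * z powi j)" for n j
  proof -
    have "qpoch ?p n * triple_coeff ?p n j \<le> 1 * (1 * (1 / L) * (1 / L))"
      unfolding triple_coeff_def using inv le1 L(1) qpoch_pos[OF p]
      by (intro mult_mono mult_nonneg_nonneg) (auto intro: less_imp_le)
    moreover have "0 \<le> qpoch ?p n * triple_coeff ?p n j"
      unfolding triple_coeff_def using inv qpoch_pos[OF p]
      by (intro mult_nonneg_nonneg) (auto intro: less_imp_le)
    ultimately have "\<bar>qpoch ?p n * triple_coeff ?p n j\<bar> * (q powi (j * j) * z powi j)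
        \<le> 1 * (1 * (1 / L) * (1 / L)) * (q powi (j * j) * z powi j)"
      using q z by (intro mult_right_mono) auto
    moreover have "\<bar>g n j\<bar> = \<bar>qpoch ?p n * triple_coeff ?p n j\<bar> * (q powi (j * j) * z powi j)"
      using q z by (simp add: g_def abs_mult power_int_abs)
    ultimately show ?thesis by simp
  qed
  have inv_lim: "(\<lambda>n. qpoch_inv ?p (int n + j)) \<longlonglongrightarrow> 1 / L" for j
  proof -
    have "filterlim (\<lambda>n. nat (int n + j)) sequentially sequentially"
      unfolding filterlim_at_top
    proof
      fix N show "\<forall>\<^sub>F n in sequentially. N \<le> nat (int n + j)"
        by (rule eventually_sequentiallyI[of "N + nat \<bar>j\<bar>"]) linarith
    qed
    then have "(\<lambda>n. 1 / qpoch ?p (nat (int n + j))) \<longlonglongrightarrow> 1 / L"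
      using L by (intro tendsto_intros filterlim_compose[OF L(2)]) auto
    moreover have "\<forall>\<^sub>F n in sequentially. 1 / qpoch ?p (nat (int n + j)) = qpoch_inv ?p (int n + j)"
      by (rule eventually_sequentiallyI[of "nat \<bar>j\<bar>"]) (auto simp: qpoch_inv_def)
    ultimately show ?thesis by (rule Lim_transform_eventually)
  qed
  have "filterlim (\<lambda>n::nat. 2 * n) sequentially sequentially"
    by (rule filterlim_subseq) (simp add: strict_mono_def)
  then have "(\<lambda>n. qpoch ?p (2 * n)) \<longlonglongrightarrow> L" by (rule filterlim_compose[OF L(2)])
  then have lim: "(\<lambda>n. g n j) \<longlonglongrightarrow> (-1) powi j * (L * (L * (1 / L) * (1 / L))) * (q powi (j * j) * z powi j)" for j
    unfolding g_def triple_coeff_def using inv_lim[of j] inv_lim[of "- j"]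
    by (intro tendsto_intros L(2)) auto
  have "(\<lambda>n. infsum (g n) UNIV) \<longlonglongrightarrow> (\<Sum>\<^sub>\<infinity>j\<in>UNIV. (-1) powi j * (L * (L * (1 / L) * (1 / L))) * (q powi (j * j) * z powi j))"
    by (rule infsum_dominated_convergence[OF lim summable_on_cmult_right[OF sum] bound])
  moreover have "infsum (g n) UNIV =
    (\<Prod>k<n. (1 - (q\<^sup>2) ^ Suc k) * ((1 - z * q ^ (2 * k + 1)) * (1 - q ^ (2 * k + 1) / z)))" for n
    using has_sum_cmult_right[OF finite_triple_product[OF q z, of n], of "qpoch ?p n"]
    unfolding g_def prod.distrib qpoch_def by (intro infsumI) (simp add: ac_simps)
  ultimately show ?thesis using L(1) by simp
qed

section \<open>Bounds on the weight of a zero step\<close>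

text \<open>The series is the theta series of the triple product at z = exp (-f / \<sigma>^2). Both
  bounds are proved for the partial products and passed to the limit.\<close>

lemma rest_prob_bounds:
  fixes \<sigma> f :: real
  assumes s: "0 < \<sigma>" and f: "\<bar>f\<bar> \<le> 1 / 2"
  defines "q \<equiv> exp (- 1 / (2 * \<sigma>\<^sup>2))"
  shows "0 \<le> rest_prob \<sigma> f" "rest_prob \<sigma> f \<le> exp (- ((q\<^sup>2 + 2 * q) / (1 - q\<^sup>2)))"
proof -
  define z where "z = exp (- f / \<sigma>\<^sup>2)"
  have q: "0 < q" "q < 1" and z: "0 < z" using s by (auto simp: q_def z_def)
  have p: "0 < q\<^sup>2" "q\<^sup>2 < 1" using q by (auto simp: power_less_one_iff)
  have e: "exp (- ((real_of_int j)\<^sup>2 + 2 * f * real_of_int j) / (2 * \<sigma>\<^sup>2)) = q powi (j * j) * z powi j" for j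
  proof -
    have "- ((real_of_int j)\<^sup>2 + 2 * f * real_of_int j) / (2 * \<sigma>\<^sup>2)
        = of_int (j * j) * (- 1 / (2 * \<sigma>\<^sup>2)) + of_int j * (- f / \<sigma>\<^sup>2)"
      using s by (simp add: field_simps power2_eq_square)
    then show ?thesis by (simp only: q_def z_def exp_add exp_power_int)
  qed
  define F where "F n = (\<Prod>k<n. (1 - (q\<^sup>2) ^ Suc k) * ((1 - z * q ^ (2 * k + 1)) * (1 - q ^ (2 * k + 1) / z)))" for n
  have lim: "F \<longlonglongrightarrow> rest_prob \<sigma> f"
    unfolding F_def rest_prob_def e
    by (rule jacobi_triple_product_limit[OF q z]) (rule summable_on_gauss_int[OF s, of f, unfolded e])
  \<comment> \<open>These numbers are exp (-(1 + 2 f) / (2 \<sigma>^2)) and exp (-(1 - 2 f) / (2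
    \<sigma>^2)), so this is where the bound on f enters; it makes every factor of the product
    nonnegative.\<close>
  have zq: "z * q \<le> 1" "q / z \<le> 1"
    using f s unfolding q_def z_def
    by (auto simp flip: exp_add exp_diff simp: divide_simps)
  have le1: "z * q ^ (2 * k + 1) \<le> 1" "q ^ (2 * k + 1) / z \<le> 1" "(q\<^sup>2) ^ Suc k \<le> 1" for k
  proof -
    have "q ^ (2 * k) \<le> 1" using q by (intro power_le_one) auto
    then have "(z * q) * q ^ (2 * k) \<le> 1" "(q / z) * q ^ (2 * k) \<le> 1"
      using zq q z by (auto intro!: mult_le_one simp del: times_divide_eq_left)
    then show "z * q ^ (2 * k + 1) \<le> 1" "q ^ (2 * k + 1) / z \<le> 1" by (simp_all add: mult_ac)
    show "(q\<^sup>2) ^ Suc k \<le> 1" using p by (simp del: power_Suc add: power_le_one)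
  qed
  have F0: "0 \<le> F n" for n
    unfolding F_def using le1 by (intro prod_nonneg mult_nonneg_nonneg) auto
  show "0 \<le> rest_prob \<sigma> f"
    using F0 by (intro LIMSEQ_le_const[OF lim]) auto
  have z2: "2 \<le> z + 1 / z"
  proof -
    have "0 \<le> (z - 1)\<^sup>2" by simp
    then show ?thesis using z by (simp add: field_simps power2_eq_square)
  qed
  \<comment> \<open>By 1 - x \<le> exp (-x) the factors of index k contribute the exponent q^(2k+2)
    + q^(2k+1) (z + 1 / z), up to sign. Replacing z + 1 / z by 2 removes f and leaves a geometric
    term.\<close>
  have le: "F n \<le> exp (- (\<Sum>k<n. (q\<^sup>2 + 2 * q) * (q\<^sup>2) ^ k))" for n
  proof -
    have "F n \<le> (\<Prod>k<n. exp (- ((q\<^sup>2 + 2 * q) * (q\<^sup>2) ^ k)))"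
      unfolding F_def
    proof (rule prod_mono, rule conjI)
      fix k
      show "0 \<le> (1 - (q\<^sup>2) ^ Suc k) * ((1 - z * q ^ (2 * k + 1)) * (1 - q ^ (2 * k + 1) / z))"
        using le1 by (intro mult_nonneg_nonneg) auto
      have x: "1 - x \<le> exp (- x)" for x :: real using exp_ge_add_one_self[of "- x"] by simp
      have "(1 - (q\<^sup>2) ^ Suc k) * ((1 - z * q ^ (2 * k + 1)) * (1 - q ^ (2 * k + 1) / z))
          \<le> exp (- ((q\<^sup>2) ^ Suc k)) * (exp (- (z * q ^ (2 * k + 1))) * exp (- (q ^ (2 * k + 1) / z)))"
        using le1 by (intro mult_mono x mult_nonneg_nonneg) auto
      also have "\<dots> = exp (- ((q\<^sup>2) ^ Suc k + q ^ (2 * k + 1) * (z + 1 / z)))"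
        unfolding exp_add[symmetric] by (simp add: algebra_simps)
      also have "\<dots> \<le> exp (- ((q\<^sup>2) ^ Suc k + q ^ (2 * k + 1) * 2))"
        using z2 q by (simp add: mult_left_mono)
      also have "(q\<^sup>2) ^ Suc k + q ^ (2 * k + 1) * 2 = (q\<^sup>2 + 2 * q) * (q\<^sup>2) ^ k"
        unfolding power_add power_Suc power_one_right power_mult[of q 2 k] by (simp only: ring_distribs mult_ac)
      finally show "(1 - (q\<^sup>2) ^ Suc k) * ((1 - z * q ^ (2 * k + 1)) * (1 - q ^ (2 * k + 1) / z))
          \<le> exp (- ((q\<^sup>2 + 2 * q) * (q\<^sup>2) ^ k))" .
    qed
    also have "\<dots> = exp (- (\<Sum>k<n. (q\<^sup>2 + 2 * q) * (q\<^sup>2) ^ k))"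
      by (simp add: exp_sum sum_negf[symmetric])
    finally show ?thesis .
  qed
  have "(\<lambda>k. (q\<^sup>2 + 2 * q) * (q\<^sup>2) ^ k) sums ((q\<^sup>2 + 2 * q) * (1 / (1 - q\<^sup>2)))"
    using p by (intro sums_mult geometric_sums) auto
  then have "(\<lambda>n. exp (- (\<Sum>k<n. (q\<^sup>2 + 2 * q) * (q\<^sup>2) ^ k))) \<longlonglongrightarrow> exp (- ((q\<^sup>2 + 2 * q) / (1 - q\<^sup>2)))"
    unfolding sums_def by (intro tendsto_exp tendsto_minus) simp
  then show "rest_prob \<sigma> f \<le> exp (- ((q\<^sup>2 + 2 * q) / (1 - q\<^sup>2)))"
    by (rule LIMSEQ_le[OF lim]) (use le in auto)
qed

text \<open>It suffices that \<sigma>^2 (1 - q^2) \<le> q^2 + 2 q. From q \<ge> 1 - 1 / (2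
  \<sigma>^2) the left side is at most (1 + q) / 2, and 1 + q \<le> 2 q^2 + 4 q holds for q \<ge>
  1/3. The latter follows from \<sigma>^2 \<ge> 1/2, which gives q \<ge> exp (-1), and from e \<le>
  3.\<close>

lemma rest_prob_le_exp:
  fixes \<sigma> f :: real
  assumes s: "0 < \<sigma>" "1 / 2 \<le> \<sigma>\<^sup>2" and f: "\<bar>f\<bar> \<le> 1 / 2"
  shows "rest_prob \<sigma> f \<le> exp (- \<sigma>\<^sup>2)"
proof -
  define q where "q = exp (- 1 / (2 * \<sigma>\<^sup>2))"
  have q: "0 < q" "q < 1" using s by (auto simp: q_def)
  then have p: "q\<^sup>2 < 1" by (simp add: power_less_one_iff)
  have "exp (- 1) \<le> q" unfolding q_def using s by (simp add: field_simps)
  moreover have "1 / 3 \<le> exp (- 1 :: real)"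
    using exp_le by (simp add: exp_minus field_simps)
  ultimately have q3: "1 / 3 \<le> q" by simp
  have "1 - 1 / (2 * \<sigma>\<^sup>2) \<le> q"
    using exp_ge_add_one_self[of "- 1 / (2 * \<sigma>\<^sup>2)"] unfolding q_def by simp
  then have "2 * \<sigma>\<^sup>2 * (1 - q) \<le> 1" using s by (simp add: field_simps)
  then have "(1 + q) * (2 * \<sigma>\<^sup>2 * (1 - q)) \<le> (1 + q) * 1"
    using q by (intro mult_left_mono) auto
  moreover have "1 / 3 * (1 / 3) \<le> q * q" using q3 by (intro mult_mono) auto
  ultimately have "\<sigma>\<^sup>2 * (1 - q\<^sup>2) \<le> q\<^sup>2 + 2 * q"
    using q3 by (simp add: power2_eq_square algebra_simps)
  then have "\<sigma>\<^sup>2 \<le> (q\<^sup>2 + 2 * q) / (1 - q\<^sup>2)" using p by (simp add: le_divide_eq)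
  then have "exp (- ((q\<^sup>2 + 2 * q) / (1 - q\<^sup>2))) \<le> exp (- \<sigma>\<^sup>2)" by simp
  then show ?thesis
    using rest_prob_bounds(2)[OF s(1) f] unfolding q_def by linarith
qed

section \<open>The random step\<close>

lemma up_prob_has_sum:
  assumes "0 < \<sigma>"
  shows "((\<lambda>k. (-1) ^ k * exp (- ((real (Suc k))\<^sup>2 + 2 * x * real (Suc k)) / (2 * \<sigma>\<^sup>2))) has_sum up_prob \<sigma> x) UNIV"
    (is "(?f has_sum _) _")
proof -
  have "summable (\<lambda>k. norm (?f k))"
    using summable_Suc_iff[THEN iffD2, OF summable_gauss[OF assms, of x]] by (simp add: abs_mult)
  then have "?f summable_on UNIV" by (rule norm_summable_imp_summable_on)
  moreover have "infsum ?f UNIV = up_prob \<sigma> x"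
    unfolding up_prob_def
  proof (rule infsum_reindex_bij_witness[where i = Suc and j = "\<lambda>k. k - 1", symmetric])
  qed auto
  ultimately show ?thesis unfolding has_sum_iff by blast
qed

lemmas up_prob_sums = up_prob_has_sum[THEN has_sum_imp_sums]

text \<open>Completing the square turns the left side into \<phi>(x + 1) - \<phi>(x + 2) + ...;
  after its first term this is minus the same series started at x + 1. For x \<ge> -1/2 it is
  detailed balance between x and x + 1: the mass stepping up from x equals the mass stepping down
  from x + 1.\<close>

lemma up_prob_shift:
  assumes s: "0 < \<sigma>"
  shows "exp (- x\<^sup>2 / (2 * \<sigma>\<^sup>2)) * up_prob \<sigma> x
    = exp (- (x + 1)\<^sup>2 / (2 * \<sigma>\<^sup>2)) * (1 - up_prob \<sigma> (x + 1))"
proof -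
  let ?e = "\<lambda>x. exp (- x\<^sup>2 / (2 * \<sigma>\<^sup>2))"
  have e: "?e x * exp (- (k\<^sup>2 + 2 * x * k) / (2 * \<sigma>\<^sup>2)) = ?e (x + k)" for x k
  proof -
    have "- x\<^sup>2 + - (k\<^sup>2 + 2 * x * k) = - (x + k)\<^sup>2" by (simp add: power2_eq_square algebra_simps)
    then show ?thesis by (simp only: exp_add[symmetric] add_divide_distrib[symmetric])
  qed
  have A: "(\<lambda>k. (-1) ^ k * ?e (x + real (Suc k))) sums (?e x * up_prob \<sigma> x)" for x
    using sums_mult[OF up_prob_sums[OF s, of x], of "?e x"]
    by (simp only: mult.left_commute[of "?e x"] e)
  from sums_minus[OF A[of "x + 1"]]
  have "(\<lambda>k. (-1) ^ Suc k * ?e (x + real (Suc (Suc k)))) sums (- (?e (x + 1) * up_prob \<sigma> (x + 1)))"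
    by (simp add: ac_simps)
  then have "(\<lambda>k. (-1) ^ k * ?e (x + real (Suc k))) sums (- (?e (x + 1) * up_prob \<sigma> (x + 1)) + ?e (x + 1))"
    by (subst (asm) sums_Suc_iff) simp
  from sums_unique2[OF A this] show ?thesis
    by (simp only: right_diff_distrib mult_1_right uminus_add_conv_diff)
qed

text \<open>For x \<ge> -1/2 the absolute values of the terms decrease and the first is at most 1,
  so Leibniz' criterion places the sum between the partial sums 0 and \<open>a 0\<close>.\<close>

lemma up_prob_bounds:
  assumes s: "0 < \<sigma>" and x: "- 1 / 2 \<le> x"
  shows "0 \<le> up_prob \<sigma> x" "up_prob \<sigma> x \<le> 1"
proof -
  define a where "a k = exp (- ((real (Suc k))\<^sup>2 + 2 * x * real (Suc k)) / (2 * \<sigma>\<^sup>2))" for k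
  have "summable a"
    using summable_gauss[OF s, of x] unfolding a_def by (subst summable_Suc_iff)
  then have a0: "a \<longlonglongrightarrow> 0" by (rule summable_LIMSEQ_zero)
  have anti: "a (Suc n) \<le> a n" for n
  proof -
    have "0 \<le> 2 * real n + 3 + 2 * x" using x by simp
    then have "- ((real (Suc (Suc n)))\<^sup>2 + 2 * x * real (Suc (Suc n))) \<le> - ((real (Suc n))\<^sup>2 + 2 * x * real (Suc n))"
      by (simp add: power2_eq_square algebra_simps)
    then show ?thesis unfolding a_def using s by (simp add: divide_right_mono del: of_nat_Suc)
  qed
  have u: "up_prob \<sigma> x = (\<Sum>k. (-1) ^ k * a k)"
    using up_prob_sums[OF s, of x] unfolding a_def by (simp add: sums_iff)
  have pos: "0 \<le> a n" for n by (simp add: a_def)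
  have "a 0 \<le> 1" using x s by (simp add: a_def divide_nonpos_nonneg)
  then show "0 \<le> up_prob \<sigma> x" "up_prob \<sigma> x \<le> 1"
    unfolding u using summable_Leibniz'(2,4)[OF a0 pos anti, of 0] by simp_all
qed

text \<open>The bilateral series splits into positive indices, negative indices and the term 1 at j
  = 0. Hence the weights near the origin sum to one, and identities for the zero step reduce to
  those for \<open>up_prob\<close>.\<close>

lemma rest_prob_eq:
  assumes s: "0 < \<sigma>"
  shows "rest_prob \<sigma> f = 1 - up_prob \<sigma> f - up_prob \<sigma> (- f)"
proof -
  let ?g = "\<lambda>j::int. (-1) powi j * exp (- ((real_of_int j)\<^sup>2 + 2 * f * real_of_int j) / (2 * \<sigma>\<^sup>2))"
  have pow: "(- 1) powi int (Suc k) = - 1 * (- 1 :: real) ^ k" for k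
    by (simp only: power_int_of_nat power_Suc)
  then have pow': "(- 1) powi - int (Suc k) = - 1 * (- 1 :: real) ^ k" for k
    by (simp only: power_int_minus) (simp flip: power_inverse)
  have "(?g has_sum - up_prob \<sigma> f) (range (\<lambda>k. int (Suc k)))"
  proof (subst has_sum_reindex)
    show "((?g \<circ> (\<lambda>k. int (Suc k))) has_sum - up_prob \<sigma> f) UNIV"
      using has_sum_cmult_right[OF up_prob_has_sum[OF s, of f], of "- 1"]
      by (simp only: o_def pow of_int_of_nat_eq mult.assoc mult_1_left mult_minus_left)
  qed (simp add: inj_on_def)
  moreover have "(?g has_sum - up_prob \<sigma> (- f)) (range (\<lambda>k. - int (Suc k)))"
  proof (subst has_sum_reindex)
    show "((?g \<circ> (\<lambda>k. - int (Suc k))) has_sum - up_prob \<sigma> (- f)) UNIV"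
      using has_sum_cmult_right[OF up_prob_has_sum[OF s, of "- f"], of "- 1"]
      by (simp only: o_def pow' of_int_of_nat_eq of_int_minus mult.assoc mult_minus1
          power2_minus minus_mult_commute mult_minus_right mult_minus_left mult_1_left)
  qed (simp add: inj_on_def)
  ultimately have "(?g has_sum (- up_prob \<sigma> f + - up_prob \<sigma> (- f)))
      (range (\<lambda>k. int (Suc k)) \<union> range (\<lambda>k. - int (Suc k)))"
    by (rule has_sum_Un_disjoint) auto
  moreover have "(?g has_sum 1) {0}" by (rule has_sum_finiteI) auto
  ultimately have "(?g has_sum (- up_prob \<sigma> f + - up_prob \<sigma> (- f) + 1))
      (range (\<lambda>k. int (Suc k)) \<union> range (\<lambda>k. - int (Suc k)) \<union> {0})"
    by (rule has_sum_Un_disjoint) auto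
  moreover have "j \<in> range (\<lambda>k. int (Suc k)) \<union> range (\<lambda>k. - int (Suc k)) \<union> {0}" for j :: int
  proof (cases j rule: int_cases3)
    case (pos n) then show ?thesis by (auto intro!: image_eqI[of _ _ "n - 1"])
  next
    case (neg n) then show ?thesis by (auto intro!: image_eqI[of _ _ "n - 1"])
  qed auto
  then have "range (\<lambda>k. int (Suc k)) \<union> range (\<lambda>k. - int (Suc k)) \<union> {0} = UNIV" by blast
  ultimately show ?thesis unfolding rest_prob_def by (auto dest!: infsumI)
qed

section \<open>The distribution of one step\<close>

text \<open>The rounding drops out because m + f = x and, for m \<le> -1, \<bar>m\<bar> - f = -x;
  only the position of x relative to -1/2 and 1/2 matters.\<close>

lemma step_prob_alt:
  "step_prob \<sigma> x k =
    (if 1 / 2 \<le> x then (if k = 1 then up_prob \<sigma> x else if k = -1 then 1 - up_prob \<sigma> x else 0)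
     else if x < - 1 / 2 then (if k = -1 then up_prob \<sigma> (- x) else if k = 1 then 1 - up_prob \<sigma> (- x) else 0)
     else (if k = 1 then up_prob \<sigma> x else if k = -1 then up_prob \<sigma> (- x)
           else if k = 0 then rest_prob \<sigma> x else 0))"
proof -
  consider "1 / 2 \<le> x" | "x < - 1 / 2" | "- 1 / 2 \<le> x" "x < 1 / 2" by linarith
  then show ?thesis
  proof cases
    case 1 then have "1 \<le> round x" unfolding round_def by linarith
    with 1 show ?thesis by (simp add: step_prob_def)
  next
    case 2 then have "round x \<le> - 1" unfolding round_def by linarith
    with 2 show ?thesis by (simp add: step_prob_def)
  next
    case 3 then have "round x = 0" unfolding round_def by linarith
    with 3 show ?thesis by (simp add: step_prob_def)
  qed
qed

lemma step_prob_nonneg: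
  assumes s: "0 < \<sigma>"
  shows "0 \<le> step_prob \<sigma> x k"
proof -
  have "0 \<le> up_prob \<sigma> x \<and> up_prob \<sigma> x \<le> 1" if "- 1 / 2 \<le> x" for x
    using up_prob_bounds[OF s that] by blast
  moreover have "0 \<le> rest_prob \<sigma> x" if "- 1 / 2 \<le> x" "x < 1 / 2"
    using that by (intro rest_prob_bounds(1)[OF s]) (simp add: abs_le_iff)
  ultimately show ?thesis unfolding step_prob_alt by simp
qed

lemma step_prob_eq_0: "k \<notin> {-1, 0, 1} \<Longrightarrow> step_prob \<sigma> x k = 0"
  by (auto simp: step_prob_alt)

lemma sum_step_prob: "0 < \<sigma> \<Longrightarrow> (\<Sum>k\<in>{-1, 0, 1}. step_prob \<sigma> x k) = 1"
  by (simp add: step_prob_alt rest_prob_eq)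

lemma pmf_step_pmf:
  assumes s: "0 < \<sigma>"
  shows "pmf (step_pmf \<sigma> x) k = step_prob \<sigma> x k"
  unfolding step_pmf_def
proof (rule pmf_embed_pmf)
  show "0 \<le> step_prob \<sigma> x k" for k using s by (rule step_prob_nonneg)
  have "(\<integral>\<^sup>+k. ennreal (step_prob \<sigma> x k) \<partial>count_space UNIV) = (\<Sum>k\<in>{-1, 0, 1}. ennreal (step_prob \<sigma> x k))"
    by (rule nn_integral_count_space'[OF _ _ subset_UNIV]) (auto simp: step_prob_eq_0)
  also have "\<dots> = ennreal (\<Sum>k\<in>{-1, 0, 1}. step_prob \<sigma> x k)"
    using s by (intro sum_ennreal) (auto intro: step_prob_nonneg)
  finally show "(\<integral>\<^sup>+k. ennreal (step_prob \<sigma> x k) \<partial>count_space UNIV) = 1"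
    by (simp only: sum_step_prob[OF s] ennreal_1)
qed

lemma nn_integral_step_pmf:
  assumes s: "0 < \<sigma>"
  shows "(\<integral>\<^sup>+k. f k \<partial>step_pmf \<sigma> x) = (\<Sum>k\<in>{-1, 0, 1}. f k * ennreal (step_prob \<sigma> x k))"
proof -
  have "set_pmf (step_pmf \<sigma> x) \<subseteq> {-1, 0, 1}"
    using step_prob_eq_0[of _ \<sigma> x] by (auto simp: set_pmf_eq pmf_step_pmf[OF s])
  then show ?thesis
    by (subst nn_integral_measure_pmf_support[of "{-1, 0, 1}"])
      (auto simp: pmf_step_pmf[OF s] simp flip: set_pmf_iff)
qed

text \<open>Stationarity of the Gaussian weight on the coset of the integers through x: the left
  side is the mass arriving at x from x + 1, x and x - 1.\<close>

lemma step_prob_fixed_point: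
  assumes s: "0 < \<sigma>"
  shows "(\<Sum>k\<in>{-1, 0, 1}. exp (- (x - of_int k)\<^sup>2 / (2 * \<sigma>\<^sup>2)) * step_prob \<sigma> (x - of_int k) k)
    = exp (- x\<^sup>2 / (2 * \<sigma>\<^sup>2))"
proof -
  define e where "e x = exp (- x\<^sup>2 / (2 * \<sigma>\<^sup>2))" for x :: real
  have sh: "e x * up_prob \<sigma> x = e (x + 1) * (1 - up_prob \<sigma> (x + 1))" for x
    unfolding e_def by (rule up_prob_shift[OF s])
  have neg: "e (- x) = e x" for x by (simp add: e_def)
  \<comment> \<open>The shift identity at x - 1, x, -x and -x - 1; as \<open>e\<close> is even, the
    last two serve the steps from the negative side. Together they settle every case of the
    piecewise weights.\<close>
  have "e (x - 1) * up_prob \<sigma> (x - 1) = e x * (1 - up_prob \<sigma> x)"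
    and "e x * up_prob \<sigma> x = e (x + 1) * (1 - up_prob \<sigma> (x + 1))"
    and "e x * up_prob \<sigma> (- x) = e (x - 1) * (1 - up_prob \<sigma> (1 - x))"
    and "e (x + 1) * up_prob \<sigma> (- x - 1) = e x * (1 - up_prob \<sigma> (- x))"
    using sh[of "x - 1"] sh[of x] sh[of "- x"] sh[of "- x - 1"] neg[of x] neg[of "x - 1"] neg[of "x + 1"]
    by simp_all
  then have "e (x + 1) * step_prob \<sigma> (x + 1) (- 1) + e x * step_prob \<sigma> x 0
      + e (x - 1) * step_prob \<sigma> (x - 1) 1 = e x"
    by (simp add: step_prob_alt rest_prob_eq[OF s]) (simp add: algebra_simps)
  then show ?thesis unfolding e_def[symmetric] by simp
qed

section \<open>Measurability and the uniform bound for a zero step\<close>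

lemma borel_measurable_up_prob [measurable]:
  assumes "0 < \<sigma>"
  shows "up_prob \<sigma> \<in> borel_measurable borel"
proof -
  have "up_prob \<sigma> = (\<lambda>x. \<Sum>k. (-1) ^ k * exp (- ((real (Suc k))\<^sup>2 + 2 * x * real (Suc k)) / (2 * \<sigma>\<^sup>2)))"
    using up_prob_sums[OF assms] by (auto simp: sums_iff)
  also have "\<dots> \<in> borel_measurable borel" by measurable
  finally show ?thesis .
qed

lemma borel_measurable_step_prob:
  assumes s: "0 < \<sigma>"
  shows "(\<lambda>x. step_prob \<sigma> x k) \<in> borel_measurable borel"
  unfolding step_prob_alt rest_prob_eq[OF s] using borel_measurable_up_prob[OF s, measurable]
  by measurable

lemma step_prob_0_le_exp:
  assumes "0 < \<sigma>" "1 / 2 \<le> \<sigma>\<^sup>2"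
  shows "step_prob \<sigma> x 0 \<le> exp (- \<sigma>\<^sup>2)"
  using rest_prob_le_exp[OF assms, of x] by (auto simp: step_prob_alt abs_le_iff)

section \<open>Invariance of the Gaussian measure\<close>

text \<open>Tonelli's theorem for products over \<open>Basis\<close>, carried to the index type by
  the bijection sending i to \<open>axis i 1\<close>.\<close>

lemma nn_integral_lborel_vec_prod:
  fixes f :: "'n::finite \<Rightarrow> real \<Rightarrow> ennreal"
  assumes [measurable]: "\<And>i. f i \<in> borel_measurable borel"
  shows "(\<integral>\<^sup>+w. (\<Prod>i\<in>UNIV. f i (w $ i)) \<partial>lborel) = (\<Prod>i\<in>UNIV. \<integral>\<^sup>+x. f i x \<partial>lborel)"
proof -
  let ?a = "\<lambda>i::'n. axis i (1 :: real)"
  have inj: "inj ?a" by (auto simp: inj_def axis_eq_axis)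
  have basis: "(Basis :: (real ^ 'n) set) = range ?a" by (auto simp: Basis_vec_def)
  have prod: "(\<Prod>b\<in>Basis. g b) = (\<Prod>i\<in>UNIV. g (?a i))" for g :: "real ^ 'n \<Rightarrow> ennreal"
    unfolding basis by (subst prod.reindex[OF inj]) simp
  show ?thesis
    using nn_integral_lborel_prod[of "\<lambda>b. f (inv ?a b)"]
    by (simp add: prod inv_f_f[OF inj] inner_axis)
qed

abbreviation gauss_density :: "real \<Rightarrow> real ^ 'n \<Rightarrow> real" where
  "gauss_density \<sigma> w \<equiv> (\<Prod>i\<in>UNIV. normal_density 0 \<sigma> (w $ i))"

text \<open>Exhibits the density as a function of the norm alone, so that it can be restricted to
  lines in an arbitrary direction.\<close>

lemma gauss_density_eq:
  fixes w :: "real ^ 'n"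
  shows "gauss_density \<sigma> w = (1 / sqrt (2 * pi * \<sigma>\<^sup>2)) ^ CARD('n) * exp (- (norm w)\<^sup>2 / (2 * \<sigma>\<^sup>2))"
proof -
  have "(norm w)\<^sup>2 = (\<Sum>i\<in>UNIV. (w $ i)\<^sup>2)"
    by (simp add: norm_vec_def L2_set_def sum_nonneg)
  then show ?thesis
    unfolding normal_density_def prod.distrib prod_constant exp_sum[OF finite, symmetric]
    by (simp add: sum_divide_distrib sum_negf)
qed

lemma nn_integral_normal_density: "0 < \<sigma> \<Longrightarrow> (\<integral>\<^sup>+x. ennreal (normal_density \<mu> \<sigma> x) \<partial>lborel) = 1"
  by (subst nn_integral_eq_integral) auto

lemma nn_integral_isotropic_gaussian:
  assumes "h \<in> borel_measurable borel"
  shows "(\<integral>\<^sup>+w. h w \<partial>isotropic_gaussian \<sigma>) = (\<integral>\<^sup>+w. ennreal (gauss_density \<sigma> w) * h w \<partial>lborel)"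
  unfolding isotropic_gaussian_def using assms by (subst nn_integral_density) auto

lemma sets_isotropic_gaussian [simp, measurable_cong]: "sets (isotropic_gaussian \<sigma>) = sets borel"
  and space_isotropic_gaussian [simp]: "space (isotropic_gaussian \<sigma>) = UNIV"
  by (simp_all add: isotropic_gaussian_def)

text \<open>Exponential tilting: completing the square in coordinate k moves its mean to c
  \<sigma>^2 at the cost of the stated factor, and all remaining densities integrate to 1. The case
  c = 0 gives total mass 1.\<close>

lemma nn_integral_exp_isotropic_gaussian:
  fixes k :: "'n::finite"
  assumes s: "0 < \<sigma>"
  shows "(\<integral>\<^sup>+w. ennreal (exp (c * w $ k)) \<partial>isotropic_gaussian \<sigma>) = ennreal (exp (c\<^sup>2 * \<sigma>\<^sup>2 / 2))"
proof -
  define f where "f i x = (if i = k then ennreal (exp (c\<^sup>2 * \<sigma>\<^sup>2 / 2)) * ennreal (normal_density (c * \<sigma>\<^sup>2) \<sigma> x)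
      else ennreal (normal_density 0 \<sigma> x))" for i :: 'n and x
  have [measurable]: "f i \<in> borel_measurable borel" for i unfolding f_def by (cases "i = k") auto
  have tilt: "normal_density 0 \<sigma> x * exp (c * x) = exp (c\<^sup>2 * \<sigma>\<^sup>2 / 2) * normal_density (c * \<sigma>\<^sup>2) \<sigma> x" for x
  proof -
    have "- (x - 0)\<^sup>2 / (2 * \<sigma>\<^sup>2) + c * x = c\<^sup>2 * \<sigma>\<^sup>2 / 2 + - (x - c * \<sigma>\<^sup>2)\<^sup>2 / (2 * \<sigma>\<^sup>2)"
      using s by (simp add: field_simps power2_eq_square)
    then have "exp (- (x - 0)\<^sup>2 / (2 * \<sigma>\<^sup>2)) * exp (c * x) = exp (c\<^sup>2 * \<sigma>\<^sup>2 / 2) * exp (- (x - c * \<sigma>\<^sup>2)\<^sup>2 / (2 * \<sigma>\<^sup>2))"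
      by (simp only: exp_add[symmetric])
    then show ?thesis unfolding normal_density_def by (simp only: mult.assoc mult.left_commute)
  qed
  have "ennreal (gauss_density \<sigma> w) * ennreal (exp (c * w $ k)) = (\<Prod>i\<in>UNIV. f i (w $ i))" for w :: "real ^ 'n"
  proof -
    have "gauss_density \<sigma> w * exp (c * w $ k)
        = normal_density 0 \<sigma> (w $ k) * exp (c * w $ k) * (\<Prod>i\<in>UNIV - {k}. normal_density 0 \<sigma> (w $ i))"
      by (subst prod.remove[of _ k]) (auto simp: ac_simps)
    then show ?thesis
      by (subst prod.remove[of _ k])
        (auto simp: f_def tilt ennreal_mult'[symmetric] prod_ennreal prod_nonneg)
  qed
  then have "(\<integral>\<^sup>+w. ennreal (exp (c * w $ k)) \<partial>isotropic_gaussian \<sigma>) = (\<integral>\<^sup>+w. (\<Prod>i\<in>UNIV. f i (w $ i)) \<partial>lborel)"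
    by (subst nn_integral_isotropic_gaussian) auto
  also have "\<dots> = (\<Prod>i\<in>UNIV. \<integral>\<^sup>+x. f i x \<partial>lborel)"
    by (rule nn_integral_lborel_vec_prod) measurable
  also have "\<dots> = (\<Prod>i\<in>UNIV. if i = k then ennreal (exp (c\<^sup>2 * \<sigma>\<^sup>2 / 2)) else 1)"
    using s by (intro prod.cong) (auto simp: f_def nn_integral_cmult nn_integral_normal_density)
  also have "\<dots> = ennreal (exp (c\<^sup>2 * \<sigma>\<^sup>2 / 2))" by simp
  finally show ?thesis .
qed

lemma prob_space_isotropic_gaussian:
  assumes s: "0 < \<sigma>"
  shows "prob_space (isotropic_gaussian \<sigma> :: (real ^ 'n) measure)"
proof
  show "emeasure (isotropic_gaussian \<sigma>) (space (isotropic_gaussian \<sigma> :: (real ^ 'n) measure)) = 1"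
    using nn_integral_exp_isotropic_gaussian[OF s, of 0 "undefined :: 'n"] by (simp add: one_ennreal_def[symmetric])
qed

text \<open>Substituting w - k v for w in the integral belonging to the step k turns every test
  value into h w. Its total weight is then the mass arriving at w along the line in direction v,
  which the one-dimensional identity evaluates.\<close>

lemma step_preserves_isotropic_gaussian:
  fixes v :: "real ^ 'n"
  assumes s: "0 < \<sigma>" and v: "v \<noteq> 0" and h [measurable]: "h \<in> borel_measurable borel"
  shows "(\<integral>\<^sup>+w. \<integral>\<^sup>+k. h (w + of_int k *\<^sub>R v) \<partial>step_pmf (\<sigma> / norm v) (w \<bullet> v / (norm v)\<^sup>2) \<partial>isotropic_gaussian \<sigma>)
    = (\<integral>\<^sup>+w. h w \<partial>isotropic_gaussian \<sigma>)"
proof -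
  define s' where "s' = \<sigma> / norm v"
  have s': "0 < s'" using s v by (simp add: s'_def)
  define x where "x w = w \<bullet> v / (norm v)\<^sup>2" for w
  have [measurable]: "x \<in> borel_measurable borel" unfolding x_def by measurable
  note [measurable] = measurable_compose[OF _ borel_measurable_step_prob[OF s']]
  let ?K = "{-1, 0, 1 :: int}"
  have fixed: "(\<Sum>k\<in>?K. gauss_density \<sigma> (w - of_int k *\<^sub>R v) * step_prob s' (x w - of_int k) k)
      = gauss_density \<sigma> w" for w
  proof -
    \<comment> \<open>Completing the square along v: the first two factors do not depend on k, and
      the third is the one-dimensional weight of deviation \<sigma> / norm v.\<close>
    have g: "gauss_density \<sigma> (w - of_int k *\<^sub>R v)
        = gauss_density \<sigma> w * exp ((x w)\<^sup>2 / (2 * s'\<^sup>2)) * exp (- (x w - of_int k)\<^sup>2 / (2 * s'\<^sup>2))" for k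
    proof -
      have nv: "norm v \<noteq> 0" using v by simp
      have n: "(norm (w - of_int k *\<^sub>R v))\<^sup>2 = (norm w)\<^sup>2 - 2 * of_int k * (w \<bullet> v) + (of_int k)\<^sup>2 * (norm v)\<^sup>2"
        unfolding power2_norm_eq_inner
        by (simp add: inner_diff_left inner_diff_right inner_commute power2_eq_square algebra_simps)
      have xv: "w \<bullet> v = x w * (norm v)\<^sup>2" using nv by (simp add: x_def)
      have s2: "2 * s'\<^sup>2 = 2 * \<sigma>\<^sup>2 / (norm v)\<^sup>2" by (simp add: s'_def power_divide)
      have "- (norm (w - of_int k *\<^sub>R v))\<^sup>2 / (2 * \<sigma>\<^sup>2)
          = - (norm w)\<^sup>2 / (2 * \<sigma>\<^sup>2) + (x w)\<^sup>2 / (2 * s'\<^sup>2) + - (x w - of_int k)\<^sup>2 / (2 * s'\<^sup>2)"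
        unfolding n xv s2 using nv s by (simp add: field_simps power2_eq_square)
      then show ?thesis by (simp only: gauss_density_eq exp_add mult.assoc)
    qed
    show ?thesis
      unfolding g mult.assoc sum_distrib_left[symmetric] step_prob_fixed_point[OF s']
      by (simp flip: exp_add)
  qed
  have sh: "x (w - of_int k *\<^sub>R v) = x w - of_int k" for w k
    using v by (simp add: x_def inner_diff_left diff_divide_distrib power2_norm_eq_inner)
  have trans: "(\<integral>\<^sup>+w. f w \<partial>lborel) = (\<integral>\<^sup>+w. f (w - c) \<partial>lborel)"
    if [measurable]: "f \<in> borel_measurable borel" for f :: "real ^ 'n \<Rightarrow> ennreal" and c
  proof -
    have "(\<integral>\<^sup>+w. f w \<partial>lborel) = (\<integral>\<^sup>+w. f w \<partial>distr lborel borel ((+) (- c)))"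
      by (simp only: lborel_distr_plus)
    also have "\<dots> = (\<integral>\<^sup>+w. f (w - c) \<partial>lborel)"
      by (subst nn_integral_distr) auto
    finally show ?thesis .
  qed
  have "(\<integral>\<^sup>+w. \<integral>\<^sup>+k. h (w + of_int k *\<^sub>R v) \<partial>step_pmf s' (x w) \<partial>isotropic_gaussian \<sigma>)
      = (\<integral>\<^sup>+w. ennreal (gauss_density \<sigma> w) * (\<Sum>k\<in>?K. h (w + of_int k *\<^sub>R v) * ennreal (step_prob s' (x w) k)) \<partial>lborel)"
    unfolding nn_integral_step_pmf[OF s'] by (rule nn_integral_isotropic_gaussian) measurable
  also have "\<dots> = (\<Sum>k\<in>?K. \<integral>\<^sup>+w. ennreal (gauss_density \<sigma> w) * (h (w + of_int k *\<^sub>R v) * ennreal (step_prob s' (x w) k)) \<partial>lborel)"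
    unfolding sum_distrib_left by (rule nn_integral_sum) measurable
  also have "\<dots> = (\<Sum>k\<in>?K. \<integral>\<^sup>+w. h w * ennreal (gauss_density \<sigma> (w - of_int k *\<^sub>R v) * step_prob s' (x w - of_int k) k) \<partial>lborel)"
  proof (rule sum.cong[OF refl])
    fix k
    show "(\<integral>\<^sup>+w. ennreal (gauss_density \<sigma> w) * (h (w + of_int k *\<^sub>R v) * ennreal (step_prob s' (x w) k)) \<partial>lborel)
      = (\<integral>\<^sup>+w. h w * ennreal (gauss_density \<sigma> (w - of_int k *\<^sub>R v) * step_prob s' (x w - of_int k) k) \<partial>lborel)"
      by (subst trans[where c = "of_int k *\<^sub>R v"], measurable)
        (simp add: sh ennreal_mult step_prob_nonneg[OF s'] prod_nonneg ac_simps)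
  qed
  also have "\<dots> = (\<integral>\<^sup>+w. (\<Sum>k\<in>?K. h w * ennreal (gauss_density \<sigma> (w - of_int k *\<^sub>R v) * step_prob s' (x w - of_int k) k)) \<partial>lborel)"
  proof (rule nn_integral_sum[symmetric])
    fix k
    have [measurable]: "(\<lambda>w. x w - real_of_int k) \<in> borel_measurable borel"
      "\<And>i. (\<lambda>w. (w - real_of_int k *\<^sub>R v) $ i) \<in> borel_measurable borel"
      by (auto intro!: borel_measurable_continuous_onI continuous_intros borel_measurable_diff)
    show "(\<lambda>w. h w * ennreal (gauss_density \<sigma> (w - of_int k *\<^sub>R v) * step_prob s' (x w - of_int k) k))
        \<in> borel_measurable lborel"
      by measurable
  qed
  also have "\<dots> = (\<integral>\<^sup>+w. ennreal (gauss_density \<sigma> w) * h w \<partial>lborel)"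
  proof (rule nn_integral_cong)
    fix w
    have "(\<Sum>k\<in>?K. ennreal (gauss_density \<sigma> (w - of_int k *\<^sub>R v) * step_prob s' (x w - of_int k) k))
        = ennreal (gauss_density \<sigma> w)"
      unfolding fixed[of w, symmetric]
      by (intro sum_ennreal mult_nonneg_nonneg prod_nonneg step_prob_nonneg[OF s']) auto
    then show "(\<Sum>k\<in>?K. h w * ennreal (gauss_density \<sigma> (w - of_int k *\<^sub>R v) * step_prob s' (x w - of_int k) k))
        = ennreal (gauss_density \<sigma> w) * h w"
      by (simp only: sum_distrib_left[symmetric] mult.commute)
  qed
  also have "\<dots> = (\<integral>\<^sup>+w. h w \<partial>isotropic_gaussian \<sigma>)"
    by (rule nn_integral_isotropic_gaussian[symmetric]) measurable
  finally show ?thesis unfolding s'_def x_def .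
qed

section \<open>Runs of the algorithm\<close>

text \<open>On a countable type measurable point masses suffice: the mass of a set is the integral
  of a jointly measurable function against the counting measure.\<close>

lemma measurable_measure_pmf_subprob_algebra:
  fixes p :: "'a \<Rightarrow> 'b::countable pmf"
  assumes [measurable]: "\<And>k. (\<lambda>x. pmf (p x) k) \<in> borel_measurable M"
  shows "(\<lambda>x. measure_pmf (p x)) \<in> measurable M (subprob_algebra (count_space UNIV))"
proof (rule measurable_subprob_algebra)
  fix A :: "'b set"
  interpret sigma_finite_measure "count_space (UNIV :: 'b set)"
    by (rule sigma_finite_measure_count_space)
  have "(\<lambda>z. ennreal (pmf (p (fst z)) (snd z)) * indicator A (snd z)) \<in> borel_measurable (M \<Otimes>\<^sub>M count_space UNIV)"
    by (rule measurable_compose_countable[where g = snd and f = "\<lambda>k z. ennreal (pmf (p (fst z)) k) * indicator A k"])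
      measurable
  then have "(\<lambda>x. \<integral>\<^sup>+k. ennreal (pmf (p x) k) * indicator A k \<partial>count_space UNIV) \<in> borel_measurable M"
    by (intro borel_measurable_nn_integral) (simp add: case_prod_beta)
  moreover have "emeasure (measure_pmf (p x)) A = (\<integral>\<^sup>+k. ennreal (pmf (p x) k) * indicator A k \<partial>count_space UNIV)" for x
    by (simp flip: nn_integral_measure_pmf)
  ultimately show "(\<lambda>x. emeasure (measure_pmf (p x)) A) \<in> borel_measurable M" by simp
qed (auto intro: measure_pmf.subprob_space_axioms)

lemma walk_add: "walk w vs js n = w + walk 0 vs js n"
  by (induction n) (auto simp: algebra_simps)

lemma walk_take: "n \<le> m \<Longrightarrow> walk w vs (take m js) n = walk w vs js n"
  by (induction n) auto

lemma walk_append: "n \<le> length js \<Longrightarrow> walk w vs (js @ ks) n = walk w vs js n"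
  by (induction n) (auto simp: nth_append)

lemma length_steps_pmf: "js \<in> set_pmf (steps_pmf \<sigma> vs w n) \<Longrightarrow> length js = n"
  by (induction n arbitrary: js) auto

lemma nn_integral_steps_pmf_Suc:
  "(\<integral>\<^sup>+js. f js \<partial>steps_pmf \<sigma> vs w (Suc n))
    = (\<integral>\<^sup>+js. \<integral>\<^sup>+k. f (js @ [k])
        \<partial>step_pmf (\<sigma> / norm (vs ! n)) ((walk w vs js n \<bullet> (vs ! n)) / (norm (vs ! n))\<^sup>2)
      \<partial>steps_pmf \<sigma> vs w n)"
  by simp

lemma nn_integral_steps_pmf_cong:
  assumes "\<And>js. length js = n \<Longrightarrow> f js = g js"
  shows "(\<integral>\<^sup>+js. f js \<partial>steps_pmf \<sigma> vs w n) = (\<integral>\<^sup>+js. g js \<partial>steps_pmf \<sigma> vs w n)"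
  by (rule nn_integral_cong_AE) (auto simp: AE_measure_pmf_iff dest!: length_steps_pmf intro: assms)

text \<open>A later step does not change the first n entries, and integrating it out contributes a
  factor 1.\<close>

lemma nn_integral_steps_pmf_take:
  assumes "n \<le> m"
  shows "(\<integral>\<^sup>+js. f (take n js) \<partial>steps_pmf \<sigma> vs w m) = (\<integral>\<^sup>+js. f js \<partial>steps_pmf \<sigma> vs w n)"
  using assms
proof (induction rule: dec_induct)
  case base
  show ?case by (rule nn_integral_steps_pmf_cong) simp
next
  case (step m)
  have "(\<integral>\<^sup>+js. f (take n js) \<partial>steps_pmf \<sigma> vs w (Suc m)) = (\<integral>\<^sup>+js. f (take n js) \<partial>steps_pmf \<sigma> vs w m)"
    unfolding nn_integral_steps_pmf_Suc
    by (rule nn_integral_steps_pmf_cong) (use step.hyps in simp)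
  with step.IH show ?case by simp
qed

text \<open>A Chernoff bound that separates x from y, whose joint law is not under control: exp (l x
  - l y) is at most the mean of exp (2 l x) and exp (-2 l y). Both signs of x - y are covered by
  adding the nonnegative terms for the other sign.\<close>

lemma one_le_exp_moments:
  fixes a l x y :: real
  assumes l: "0 \<le> l" and a: "a < \<bar>x - y\<bar>"
  shows "1 \<le> exp (- l * a) / 2 * (exp (2 * l * x) + exp (- 2 * l * x))
    + exp (- l * a) / 2 * (exp (2 * l * y) + exp (- 2 * l * y))"
proof -
  have arith: "e \<le> (p + q) / 2 + (r + s) / 2"
    if "e \<le> u \<or> e \<le> v" "u \<le> (p + s) / 2" "v \<le> (r + q) / 2" "0 \<le> p" "0 \<le> q" "0 \<le> r" "0 \<le> s"
    for e u v p q r s :: real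
    using that by (auto simp: field_simps)
  have conv: "exp (l * u + - l * v) \<le> (exp (2 * l * u) + exp (- 2 * l * v)) / 2" for u v
    using sum_squares_bound[of "exp (l * u)" "exp (- l * v)"]
    by (simp only: exp_add exp_double[symmetric]) (simp add: mult.assoc)
  have "l * a \<le> l * \<bar>x - y\<bar>" using a l by (simp add: mult_left_mono)
  then have "l * a \<le> l * x + - l * y \<or> l * a \<le> l * y + - l * x"
    by (cases "y \<le> x") (simp_all add: right_diff_distrib)
  then have "exp (l * a) \<le> exp (l * x + - l * y) \<or> exp (l * a) \<le> exp (l * y + - l * x)"
    by (simp only: exp_le_cancel_iff)
  then have "exp (l * a) \<le> (exp (2 * l * x) + exp (- 2 * l * x)) / 2 + (exp (2 * l * y) + exp (- 2 * l * y)) / 2"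
    by (rule arith[OF _ conv conv]) (rule exp_ge_zero)+
  then have "exp (- l * a) * exp (l * a)
      \<le> exp (- l * a) * ((exp (2 * l * x) + exp (- 2 * l * x)) / 2 + (exp (2 * l * y) + exp (- 2 * l * y)) / 2)"
    by (intro mult_left_mono) auto
  moreover have "exp (- l * a) * exp (l * a) = 1" by (simp flip: exp_add)
  ultimately show ?thesis by (simp only: distrib_left times_divide_eq_left times_divide_eq_right add_divide_distrib)
qed

section \<open>The joint law of the starting point and the steps\<close>

locale gaussian_run =
  fixes \<sigma> :: real and vs :: "(real ^ 'n) list"
  assumes sigma_pos: "0 < \<sigma>" and nonzero: "\<And>i. i < length vs \<Longrightarrow> vs ! i \<noteq> 0"
begin

lemma scale_pos: "i < length vs \<Longrightarrow> 0 < \<sigma> / norm (vs ! i)"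
  using sigma_pos nonzero by simp

lemma measurable_steps_pmf:
  "n \<le> length vs \<Longrightarrow> (\<lambda>w. measure_pmf (steps_pmf \<sigma> vs w n)) \<in> measurable borel (subprob_algebra (count_space UNIV))"
proof (induction n)
  case 0
  show ?case by (simp add: return_pmf.rep_eq)
next
  case (Suc n)
  then have n: "n < length vs" by simp
  let ?p = "\<lambda>w js. step_pmf (\<sigma> / norm (vs ! n)) ((walk w vs js n \<bullet> (vs ! n)) / (norm (vs ! n))\<^sup>2)"
  have 1: "(\<lambda>w. measure_pmf (?p w js)) \<in> measurable borel (subprob_algebra (count_space UNIV))" for js
  proof (rule measurable_measure_pmf_subprob_algebra)
    fix k
    have "(\<lambda>w. (walk w vs js n \<bullet> (vs ! n)) / (norm (vs ! n))\<^sup>2) \<in> borel_measurable borel"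
      by (subst walk_add) measurable
    then show "(\<lambda>w. pmf (?p w js) k) \<in> borel_measurable borel"
      unfolding pmf_step_pmf[OF scale_pos[OF n]]
      by (rule measurable_compose[OF _ borel_measurable_step_prob[OF scale_pos[OF n]]])
  qed
  have 2: "(\<lambda>w. measure_pmf (map_pmf (\<lambda>k. js @ [k]) (?p w js))) \<in> measurable borel (subprob_algebra (count_space UNIV))" for js
    unfolding map_pmf_rep_eq by (rule measurable_compose[OF 1 measurable_distr]) simp
  \<comment> \<open>There are only countably many histories \<open>js\<close>, so measurability in w
    for each fixed history gives joint measurability.\<close>
  have 3: "(\<lambda>z. measure_pmf (map_pmf (\<lambda>k. snd z @ [k]) (?p (fst z) (snd z))))
      \<in> measurable (borel \<Otimes>\<^sub>M count_space UNIV) (subprob_algebra (count_space UNIV))"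
    by (rule measurable_compose_countable[where g = snd
          and f = "\<lambda>js z. measure_pmf (map_pmf (\<lambda>k. js @ [k]) (?p (fst z) js))"])
      (auto intro: measurable_compose[OF measurable_fst 2])
  have "steps_pmf \<sigma> vs w (Suc n) = bind_pmf (steps_pmf \<sigma> vs w n) (\<lambda>js. map_pmf (\<lambda>k. js @ [k]) (?p w js))" for w
    by (simp add: map_pmf_def)
  then show ?case
    unfolding measure_pmf_bind[symmetric] using Suc
    by (simp only: measure_pmf_bind) (rule measurable_bind[OF _ 3], simp)
qed

lemma measurable_run:
  "(\<lambda>w. measure_pmf (steps_pmf \<sigma> vs w (length vs)) \<bind> (\<lambda>js. return (borel \<Otimes>\<^sub>M count_space UNIV) (w, js)))
    \<in> measurable borel (subprob_algebra (borel \<Otimes>\<^sub>M count_space UNIV))"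
  by (rule measurable_bind[OF measurable_steps_pmf[OF order_refl]]) measurable

lemma sets_partial_coloring [simp, measurable_cong]:
  "sets (partial_coloring \<sigma> vs) = sets (borel \<Otimes>\<^sub>M count_space UNIV)"
  unfolding partial_coloring_def
  by (rule sets_bind_measurable) (use measurable_run in \<open>simp_all cong: measurable_cong_sets\<close>)

lemma space_partial_coloring [simp]: "space (partial_coloring \<sigma> vs) = UNIV"
  using sets_eq_imp_space_eq[OF sets_partial_coloring] by (simp add: space_pair_measure)

lemma nn_integral_partial_coloring:
  assumes f: "f \<in> borel_measurable (borel \<Otimes>\<^sub>M count_space UNIV)"
  shows "(\<integral>\<^sup>+z. f z \<partial>partial_coloring \<sigma> vs)
    = (\<integral>\<^sup>+w. \<integral>\<^sup>+js. f (w, js) \<partial>steps_pmf \<sigma> vs w (length vs) \<partial>isotropic_gaussian \<sigma>)"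
proof -
  have "(\<integral>\<^sup>+z. f z \<partial>partial_coloring \<sigma> vs)
    = (\<integral>\<^sup>+w. \<integral>\<^sup>+z. f z \<partial>(measure_pmf (steps_pmf \<sigma> vs w (length vs)) \<bind> (\<lambda>js. return (borel \<Otimes>\<^sub>M count_space UNIV) (w, js)))
        \<partial>isotropic_gaussian \<sigma>)"
    unfolding partial_coloring_def using measurable_run
    by (intro nn_integral_bind[OF f]) (simp cong: measurable_cong_sets)
  also have "\<dots> = (\<integral>\<^sup>+w. \<integral>\<^sup>+js. f (w, js) \<partial>steps_pmf \<sigma> vs w (length vs) \<partial>isotropic_gaussian \<sigma>)"
  proof (rule nn_integral_cong)
    fix w :: "real ^ 'n"
    have "(\<integral>\<^sup>+z. f z \<partial>(measure_pmf (steps_pmf \<sigma> vs w (length vs)) \<bind> (\<lambda>js. return (borel \<Otimes>\<^sub>M count_space UNIV) (w, js))))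
      = (\<integral>\<^sup>+js. \<integral>\<^sup>+z. f z \<partial>return (borel \<Otimes>\<^sub>M count_space UNIV) (w, js) \<partial>steps_pmf \<sigma> vs w (length vs))"
      by (rule nn_integral_bind[OF f]) measurable
    also have "\<dots> = (\<integral>\<^sup>+js. f (w, js) \<partial>steps_pmf \<sigma> vs w (length vs))"
      by (subst nn_integral_return[OF _ f]) (auto simp: space_pair_measure)
    finally show "(\<integral>\<^sup>+z. f z \<partial>(measure_pmf (steps_pmf \<sigma> vs w (length vs)) \<bind> (\<lambda>js. return (borel \<Otimes>\<^sub>M count_space UNIV) (w, js))))
      = (\<integral>\<^sup>+js. f (w, js) \<partial>steps_pmf \<sigma> vs w (length vs))" .
  qed
  finally show ?thesis .
qed

lemma prob_space_partial_coloring: "prob_space (partial_coloring \<sigma> vs)"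
proof
  interpret G: prob_space "isotropic_gaussian \<sigma> :: (real ^ 'n) measure"
    by (rule prob_space_isotropic_gaussian[OF sigma_pos])
  show "emeasure (partial_coloring \<sigma> vs) (space (partial_coloring \<sigma> vs)) = 1"
    using nn_integral_partial_coloring[of "\<lambda>_. 1"] G.emeasure_space_1
    by (simp add: measure_pmf.emeasure_space_1[simplified])
qed

section \<open>Invariance along the run and the displacement tail\<close>

text \<open>Integrating out the last step replaces h by its one-step average H, to which the
  induction hypothesis applies; hence the induction is over all test functions. The invariance under
  one step then removes the average.\<close>

lemma nn_integral_walk:
  "n \<le> length vs \<Longrightarrow> h \<in> borel_measurable borel \<Longrightarrow>
    (\<integral>\<^sup>+w. \<integral>\<^sup>+js. h (walk w vs js n) \<partial>steps_pmf \<sigma> vs w n \<partial>isotropic_gaussian \<sigma>)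
      = (\<integral>\<^sup>+w. h w \<partial>isotropic_gaussian \<sigma>)"
proof (induction n arbitrary: h)
  case 0
  then show ?case by simp
next
  case (Suc n)
  then have n: "n < length vs" by simp
  note [measurable] = Suc.prems(2)
  let ?v = "vs ! n"
  define H where "H w = (\<integral>\<^sup>+k. h (w + of_int k *\<^sub>R ?v) \<partial>step_pmf (\<sigma> / norm ?v) (w \<bullet> ?v / (norm ?v)\<^sup>2))" for w
  have "H \<in> borel_measurable borel"
    unfolding H_def nn_integral_step_pmf[OF scale_pos[OF n]]
    using measurable_compose[OF _ borel_measurable_step_prob[OF scale_pos[OF n]], measurable (raw)]
    by measurable
  have "(\<integral>\<^sup>+js. h (walk w vs js (Suc n)) \<partial>steps_pmf \<sigma> vs w (Suc n))
      = (\<integral>\<^sup>+js. H (walk w vs js n) \<partial>steps_pmf \<sigma> vs w n)" for w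
    unfolding nn_integral_steps_pmf_Suc H_def
    by (rule nn_integral_steps_pmf_cong) (simp add: walk_append nth_append)
  then have "(\<integral>\<^sup>+w. \<integral>\<^sup>+js. h (walk w vs js (Suc n)) \<partial>steps_pmf \<sigma> vs w (Suc n) \<partial>isotropic_gaussian \<sigma>)
      = (\<integral>\<^sup>+w. \<integral>\<^sup>+js. H (walk w vs js n) \<partial>steps_pmf \<sigma> vs w n \<partial>isotropic_gaussian \<sigma>)"
    by (simp only:)
  also have "\<dots> = (\<integral>\<^sup>+w. H w \<partial>isotropic_gaussian \<sigma>)"
    by (rule Suc.IH) (use n \<open>H \<in> _\<close> in auto)
  also have "\<dots> = (\<integral>\<^sup>+w. h w \<partial>isotropic_gaussian \<sigma>)"
    unfolding H_def by (rule step_preserves_isotropic_gaussian) (use sigma_pos nonzero[OF n] in auto)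
  finally show ?case .
qed

text \<open>Given the steps, the displacement does not depend on the starting point, so the event is
  a cylinder over a set of lists and is measurable for every P.\<close>

lemma displacement_event:
  "{(w, js). P (walk w vs js n - w)} \<in> sets (borel \<Otimes>\<^sub>M count_space UNIV)"
proof -
  have "walk w vs js n - w = walk 0 vs js n" for w js
    using walk_add[of w vs js n] by simp
  then have "{(w, js). P (walk w vs js n - w)} = UNIV \<times> {js. P (walk 0 vs js n)}"
    by auto
  also have "\<dots> \<in> sets (borel \<Otimes>\<^sub>M count_space UNIV)" by (intro pair_measureI) auto
  finally show ?thesis .
qed

text \<open>The indicator of the event is at most F at the n-th position plus F at the start. By
  invariance both summands have the same integral, whatever the dependence between the two
  positions.\<close>

lemma emeasure_displacement_tail:
  assumes n: "n \<le> length vs" and a: "0 \<le> a"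
  shows "emeasure (partial_coloring \<sigma> vs) {(w, js). a < \<bar>(walk w vs js n - w) $ i\<bar>}
    \<le> ennreal (2 * exp (- a\<^sup>2 / (8 * \<sigma>\<^sup>2)))"
proof -
  \<comment> \<open>This value minimises the exponent -l a + 2 l^2 \<sigma>^2, with minimum -a^2 /
    (8 \<sigma>^2).\<close>
  define l where "l = a / (4 * \<sigma>\<^sup>2)"
  have l: "0 \<le> l" using a by (simp add: l_def)
  define F where "F = (\<lambda>w :: real ^ 'n.
    ennreal (exp (- l * a) / 2) * (ennreal (exp (2 * l * w $ i)) + ennreal (exp (- 2 * l * w $ i))))"
  have F [measurable]: "F \<in> borel_measurable borel" unfolding F_def by measurable
  have F_int: "(\<integral>\<^sup>+w. F w \<partial>isotropic_gaussian \<sigma>) = ennreal (exp (- a\<^sup>2 / (8 * \<sigma>\<^sup>2)))"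
  proof -
    have "(\<integral>\<^sup>+w. F w \<partial>isotropic_gaussian \<sigma>) = ennreal (exp (- l * a) / 2) *
        ((\<integral>\<^sup>+w. ennreal (exp (2 * l * w $ i)) \<partial>isotropic_gaussian \<sigma>)
          + (\<integral>\<^sup>+w. ennreal (exp (- 2 * l * w $ i)) \<partial>isotropic_gaussian \<sigma>))"
      unfolding F_def by (subst nn_integral_cmult, simp, subst nn_integral_add) simp_all
    also have "\<dots> = ennreal (exp (- l * a) / 2) *
        (ennreal (exp ((2 * l)\<^sup>2 * \<sigma>\<^sup>2 / 2)) + ennreal (exp ((- 2 * l)\<^sup>2 * \<sigma>\<^sup>2 / 2)))"
      by (simp only: nn_integral_exp_isotropic_gaussian[OF sigma_pos])
    also have "\<dots> = ennreal (exp (- l * a) / 2 * (exp ((2 * l)\<^sup>2 * \<sigma>\<^sup>2 / 2) + exp ((- 2 * l)\<^sup>2 * \<sigma>\<^sup>2 / 2)))"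
      by (simp only: ennreal_mult ennreal_plus add_nonneg_nonneg divide_nonneg_nonneg zero_le_numeral exp_ge_zero)
    also have "exp (- l * a) / 2 * (exp ((2 * l)\<^sup>2 * \<sigma>\<^sup>2 / 2) + exp ((- 2 * l)\<^sup>2 * \<sigma>\<^sup>2 / 2))
        = exp (- l * a + (2 * l)\<^sup>2 * \<sigma>\<^sup>2 / 2)"
      unfolding exp_add by simp
    also have "- l * a + (2 * l)\<^sup>2 * \<sigma>\<^sup>2 / 2 = - a\<^sup>2 / (8 * \<sigma>\<^sup>2)"
      using sigma_pos by (simp add: l_def field_simps power2_eq_square)
    finally show ?thesis .
  qed
  have F_le: "indicator {(w, js). a < \<bar>(walk w vs js n - w) $ i\<bar>} (w, js) \<le> F (walk w vs js n) + F w" for w js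
  proof (cases "a < \<bar>(walk w vs js n - w) $ i\<bar>")
    case True
    define x y where "x = walk w vs js n $ i" and "y = w $ i"
    define E P Q R S where "E = exp (- l * a)" and "P = exp (2 * l * x)" and "Q = exp (- 2 * l * x)"
      and "R = exp (2 * l * y)" and "S = exp (- 2 * l * y)"
    have nonneg: "0 \<le> E" "0 \<le> P" "0 \<le> Q" "0 \<le> R" "0 \<le> S"
      by (simp_all add: E_def P_def Q_def R_def S_def)
    have "a < \<bar>x - y\<bar>" using True by (simp add: x_def y_def)
    from one_le_exp_moments[OF l this] have "1 \<le> ennreal (E / 2 * (P + Q) + E / 2 * (R + S))"
      unfolding E_def P_def Q_def R_def S_def ennreal_ge_1 .
    also have "\<dots> = ennreal (E / 2 * (P + Q)) + ennreal (E / 2 * (R + S))"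
      using nonneg by (intro ennreal_plus mult_nonneg_nonneg add_nonneg_nonneg) auto
    also have "\<dots> = ennreal (E / 2) * (ennreal P + ennreal Q) + ennreal (E / 2) * (ennreal R + ennreal S)"
      using nonneg by (simp only: ennreal_mult ennreal_plus add_nonneg_nonneg divide_nonneg_nonneg zero_le_numeral)
    also have "\<dots> = F (walk w vs js n) + F w"
      by (simp only: F_def x_def y_def P_def Q_def R_def S_def E_def)
    finally show ?thesis using True by (simp only: indicator_simps mem_Collect_eq prod.case)
  next
    case False
    then show ?thesis by (simp only: indicator_def mem_Collect_eq prod.case of_bool_eq zero_le)
  qed
  have "emeasure (partial_coloring \<sigma> vs) {(w, js). a < \<bar>(walk w vs js n - w) $ i\<bar>}
      = (\<integral>\<^sup>+z. indicator {(w, js). a < \<bar>(walk w vs js n - w) $ i\<bar>} z \<partial>partial_coloring \<sigma> vs)"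
    by (rule nn_integral_indicator[symmetric], unfold sets_partial_coloring, rule displacement_event)
  also have "\<dots> = (\<integral>\<^sup>+w. \<integral>\<^sup>+js. indicator {(w, js). a < \<bar>(walk w vs js n - w) $ i\<bar>} (w, js)
      \<partial>steps_pmf \<sigma> vs w (length vs) \<partial>isotropic_gaussian \<sigma>)"
    by (intro nn_integral_partial_coloring borel_measurable_indicator displacement_event)
  also have "\<dots> \<le> (\<integral>\<^sup>+w. \<integral>\<^sup>+js. F (walk w vs js n) + F w \<partial>steps_pmf \<sigma> vs w (length vs) \<partial>isotropic_gaussian \<sigma>)"
    by (intro nn_integral_mono F_le)
  also have "\<dots> = (\<integral>\<^sup>+w. (\<integral>\<^sup>+js. F (walk w vs js n) \<partial>steps_pmf \<sigma> vs w n) + F w \<partial>isotropic_gaussian \<sigma>)"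
  proof (rule nn_integral_cong)
    fix w
    \<comment> \<open>The n-th position depends on the first n steps only, so the run is cut there
      to match the form of the invariance statement.\<close>
    have "(\<integral>\<^sup>+js. F (walk w vs js n) \<partial>steps_pmf \<sigma> vs w (length vs)) = (\<integral>\<^sup>+js. F (walk w vs js n) \<partial>steps_pmf \<sigma> vs w n)"
      using nn_integral_steps_pmf_take[OF n, where f = "\<lambda>js. F (walk w vs js n)" and w = w]
      by (simp only: walk_take[OF order_refl])
    moreover have "(\<integral>\<^sup>+js. F w \<partial>steps_pmf \<sigma> vs w (length vs)) = F w"
      by (simp add: measure_pmf.emeasure_space_1[simplified])
    ultimately show "(\<integral>\<^sup>+js. F (walk w vs js n) + F w \<partial>steps_pmf \<sigma> vs w (length vs))
        = (\<integral>\<^sup>+js. F (walk w vs js n) \<partial>steps_pmf \<sigma> vs w n) + F w"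
      by (subst nn_integral_add) simp_all
  qed
  also have "\<dots> = (\<integral>\<^sup>+w. (\<integral>\<^sup>+js. F (walk w vs js n) \<partial>steps_pmf \<sigma> vs w n) \<partial>isotropic_gaussian \<sigma>)
      + (\<integral>\<^sup>+w. F w \<partial>isotropic_gaussian \<sigma>)"
  proof (rule nn_integral_add)
    have "(\<lambda>z. F (walk (fst z) vs (snd z) n)) \<in> borel_measurable (borel \<Otimes>\<^sub>M count_space UNIV)"
    proof (rule measurable_compose_countable[where g = snd and f = "\<lambda>js z. F (walk (fst z) vs js n)"])
      fix js
      have "(\<lambda>w. w + walk 0 vs js n) \<in> borel_measurable borel" by measurable
      then have "(\<lambda>w. F (walk w vs js n)) \<in> borel_measurable borel"
        by (subst walk_add) (rule measurable_compose[OF _ F])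
      then show "(\<lambda>z. F (walk (fst z) vs js n)) \<in> borel_measurable (borel \<Otimes>\<^sub>M count_space UNIV)"
        by (rule measurable_compose[OF measurable_fst])
    qed (rule measurable_snd)
    then have "(\<lambda>(w, js). F (walk w vs js n)) \<in> borel_measurable (borel \<Otimes>\<^sub>M count_space UNIV)"
      by (simp only: case_prod_beta')
    from nn_integral_measurable_subprob_algebra2[OF this measurable_steps_pmf[OF n]]
    show "(\<lambda>w. \<integral>\<^sup>+js. F (walk w vs js n) \<partial>steps_pmf \<sigma> vs w n) \<in> borel_measurable (isotropic_gaussian \<sigma>)"
      unfolding measurable_cong_sets[OF sets_isotropic_gaussian refl] .
    show "F \<in> borel_measurable (isotropic_gaussian \<sigma>)"
      unfolding measurable_cong_sets[OF sets_isotropic_gaussian refl] by (rule F)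
  qed
  also have "\<dots> = ennreal (2 * exp (- a\<^sup>2 / (8 * \<sigma>\<^sup>2)))"
    unfolding nn_integral_walk[OF n F] F_int by (subst ennreal_plus[symmetric]) simp_all
  finally show ?thesis .
qed

section \<open>Zero steps\<close>

lemma steps_event: "{(w, js). P js} \<in> sets (borel \<Otimes>\<^sub>M count_space UNIV)"
proof -
  have "{(w, js). P js} = UNIV \<times> {js. P js}" by auto
  also have "\<dots> \<in> sets (borel \<Otimes>\<^sub>M count_space UNIV)" by (intro pair_measureI) auto
  finally show ?thesis .
qed

text \<open>A vector of norm at most 1 gives the parameter \<sigma> / norm v \<ge> \<sigma>, so the
  one-step bound is at least as good as for \<sigma>. It is uniform in the position and survives
  averaging over the past.\<close>

lemma emeasure_zero_step:
  assumes i: "i < length vs" and v: "norm (vs ! i) \<le> 1" and s: "1 / 2 \<le> \<sigma>\<^sup>2"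
  shows "emeasure (partial_coloring \<sigma> vs) {(w, js). js ! i = 0} \<le> ennreal (exp (- \<sigma>\<^sup>2))"
proof -
  interpret G: prob_space "isotropic_gaussian \<sigma> :: (real ^ 'n) measure"
    by (rule prob_space_isotropic_gaussian[OF sigma_pos])
  let ?s = "\<sigma> / norm (vs ! i)"
  have "\<sigma> \<le> ?s" using sigma_pos v nonzero[OF i] by (simp add: le_divide_eq mult_left_le)
  then have le: "\<sigma>\<^sup>2 \<le> ?s\<^sup>2" using sigma_pos by (intro power_mono) auto
  have p0: "step_prob ?s x 0 \<le> exp (- \<sigma>\<^sup>2)" for x
    by (rule order_trans[OF step_prob_0_le_exp[OF scale_pos[OF i]]]) (use le s in auto)
  let ?Z = "\<lambda>js. indicator {js. js ! i = (0 :: int)} js :: ennreal"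
  have [measurable]: "{(w, js). js ! i = 0} \<in> sets (borel \<Otimes>\<^sub>M count_space UNIV)"
    by (rule steps_event)
  have inner: "(\<integral>\<^sup>+js. ?Z js \<partial>steps_pmf \<sigma> vs w (length vs)) \<le> ennreal (exp (- \<sigma>\<^sup>2))" for w
  proof -
    have sum3: "(\<Sum>k\<in>{-1, 0, 1}. g k) = g (-1) + (g 0 + g 1)" for g :: "int \<Rightarrow> ennreal"
      by simp
    \<comment> \<open>Cutting the run after \<open>Suc i\<close> steps makes entry i the last one,
      whose law given the past is explicit.\<close>
    have "(\<integral>\<^sup>+js. ?Z js \<partial>steps_pmf \<sigma> vs w (length vs)) = (\<integral>\<^sup>+js. ?Z (take (Suc i) js) \<partial>steps_pmf \<sigma> vs w (length vs))"
      by (rule nn_integral_cong) (simp add: indicator_def)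
    also have "\<dots> = (\<integral>\<^sup>+js. ?Z js \<partial>steps_pmf \<sigma> vs w (Suc i))"
      by (rule nn_integral_steps_pmf_take) (use i in simp)
    also have "\<dots> = (\<integral>\<^sup>+js. ennreal (step_prob ?s ((walk w vs js i \<bullet> (vs ! i)) / (norm (vs ! i))\<^sup>2) 0) \<partial>steps_pmf \<sigma> vs w i)"
      unfolding nn_integral_steps_pmf_Suc nn_integral_step_pmf[OF scale_pos[OF i]] sum3
      by (rule nn_integral_steps_pmf_cong) (simp add: nth_append)
    also have "\<dots> \<le> (\<integral>\<^sup>+js. ennreal (exp (- \<sigma>\<^sup>2)) \<partial>steps_pmf \<sigma> vs w i)"
      by (intro nn_integral_mono ennreal_leI p0)
    also have "\<dots> = ennreal (exp (- \<sigma>\<^sup>2))" by (simp add: measure_pmf.emeasure_space_1[simplified])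
    finally show ?thesis .
  qed
  have "emeasure (partial_coloring \<sigma> vs) {(w, js). js ! i = 0}
      = (\<integral>\<^sup>+z. indicator {(w, js). js ! i = 0} z \<partial>partial_coloring \<sigma> vs)" by simp
  also have "\<dots> = (\<integral>\<^sup>+w. \<integral>\<^sup>+js. indicator {(w, js). js ! i = 0} (w, js) \<partial>steps_pmf \<sigma> vs w (length vs) \<partial>isotropic_gaussian \<sigma>)"
    by (rule nn_integral_partial_coloring) measurable
  also have "\<dots> = (\<integral>\<^sup>+w. \<integral>\<^sup>+js. ?Z js \<partial>steps_pmf \<sigma> vs w (length vs) \<partial>isotropic_gaussian \<sigma>)"
    by (simp add: indicator_def)
  also have "\<dots> \<le> (\<integral>\<^sup>+w. ennreal (exp (- \<sigma>\<^sup>2)) \<partial>(isotropic_gaussian \<sigma> :: (real ^ 'n) measure))"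
    by (intro nn_integral_mono inner)
  also have "\<dots> = ennreal (exp (- \<sigma>\<^sup>2))" using G.emeasure_space_1 by simp
  finally show ?thesis .
qed

end

section \<open>Union bounds\<close>

lemma (in prob_space) prob_ge_union_bound:
  assumes "finite I" and good: "good \<in> events" and bad: "\<And>i. i \<in> I \<Longrightarrow> bad i \<in> events"
    and le: "\<And>i. i \<in> I \<Longrightarrow> emeasure M (bad i) \<le> ennreal \<epsilon>" and \<epsilon>: "0 \<le> \<epsilon>"
    and cover: "space M - good \<subseteq> (\<Union>i\<in>I. bad i)" and card: "real (card I) * \<epsilon> \<le> \<delta>"
  shows "1 - \<delta> \<le> prob good"
proof -
  have "prob (space M - good) \<le> prob (\<Union>i\<in>I. bad i)"
    using assms by (intro finite_measure_mono) auto
  also have "\<dots> \<le> (\<Sum>i\<in>I. prob (bad i))"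
    using assms by (intro finite_measure_subadditive_finite) auto
  also have "\<dots> \<le> (\<Sum>i\<in>I. \<epsilon>)"
    using le \<epsilon> by (intro sum_mono) (simp add: emeasure_eq_measure)
  also have "\<dots> \<le> \<delta>" using card by simp
  finally show ?thesis using prob_compl[OF good] by simp
qed

lemma infnorm_le_iff_cart: "infnorm (x :: real ^ 'n) \<le> a \<longleftrightarrow> (\<forall>i. \<bar>x $ i\<bar> \<le> a)"
  unfolding infnorm_Max by (subst Max_le_iff) (auto simp: Basis_vec_def inner_axis)

theorem theorem4p2:
  fixes vs :: "(real ^ 'n) list" and t :: nat and \<delta> \<sigma> :: real
  assumes "length vs = t" and "t \<ge> 1"
    and "\<forall>i<t. vs ! i \<noteq> 0 \<and> norm (vs ! i) \<le> 1"
    and "0 < \<delta>" and "\<delta> < 1 / 2"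
    and "\<sigma> = sqrt (ln (real t / \<delta>))"
  shows
    "\<P>((w0, js) in partial_coloring \<sigma> vs.
        \<forall>l\<in>{1..t}. infnorm (walk w0 vs js l - w0)
          \<le> 2 * sqrt (2 * ln (real t / \<delta>) * ln (2 * real CARD('n) * real t / \<delta>))) \<ge> 1 - \<delta>
     \<and> \<P>((w0, js) in partial_coloring \<sigma> vs.
        infnorm (walk w0 vs js t - w0)
          \<le> 2 * sqrt (2 * ln (real t / \<delta>) * ln (2 * real CARD('n) / \<delta>))) \<ge> 1 - \<delta>
     \<and> \<P>((w0, js) in partial_coloring \<sigma> vs. \<forall>i<t. js ! i \<noteq> 0) \<ge> 1 - \<delta>"
proof -
  \<comment> \<open>Since t / \<delta> \<ge> 2, the variance is at least ln 2 \<ge> 2/3, which meets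
    the condition \<sigma>^2 \<ge> 1/2 of the zero-step bound.\<close>
  have "2 * \<delta> \<le> real t" using assms by linarith
  then have "2 \<le> real t / \<delta>" using assms by (simp add: le_divide_eq)
  then have "ln 2 \<le> ln (real t / \<delta>)" by simp
  then have lt: "1 / 2 \<le> ln (real t / \<delta>)" using ln2_ge_two_thirds by simp
  then have s2: "\<sigma>\<^sup>2 = ln (real t / \<delta>)" and s: "0 < \<sigma>" using assms by simp_all
  interpret gaussian_run \<sigma> vs
    using assms s by unfold_locales auto
  interpret P: prob_space "partial_coloring \<sigma> vs" by (rule prob_space_partial_coloring)
  have event: "{(w, js). P (walk w vs js l - w)} \<in> sets (borel \<Otimes>\<^sub>M count_space UNIV)" for P l
    by (rule displacement_event)
  have event': "{(w, js). P js} \<in> sets (borel \<Otimes>\<^sub>M count_space UNIV)" for P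
    by (rule steps_event)
  have tail_event: "{(w, js). c < \<bar>(walk w vs js l - w) $ i\<bar>} \<in> P.events" for c l i
    unfolding sets_partial_coloring by (rule event)
  \<comment> \<open>Here u stands for the number of bad events divided by \<delta>. The threshold
    has square 8 \<sigma>^2 ln (2 u), so the tail 2 exp (-ln (2 u)) is exactly 1 / u.\<close>
  have tail: "emeasure (partial_coloring \<sigma> vs)
      {(w, js). 2 * sqrt (2 * ln (real t / \<delta>) * ln (2 * u)) < \<bar>(walk w vs js l - w) $ i\<bar>} \<le> ennreal (1 / u)"
    if "l \<le> t" "1 \<le> u" for l i u
  proof -
    have "ln (2 * u) \<ge> 0" using that by simp
    then have "(2 * sqrt (2 * ln (real t / \<delta>) * ln (2 * u)))\<^sup>2 = 8 * \<sigma>\<^sup>2 * ln (2 * u)"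
      using lt by (simp add: power_mult_distrib s2)
    moreover have "exp (- ln (2 * u)) = 1 / (2 * u)" using that by (simp add: exp_minus inverse_eq_divide)
    ultimately show ?thesis
      using emeasure_displacement_tail[of l "2 * sqrt (2 * ln (real t / \<delta>) * ln (2 * u))" i] that s assms(1) lt
      by simp
  qed
  have n: "1 \<le> real CARD('n)" by (simp add: Suc_leI)
  have t: "1 \<le> real t" using assms by simp
  have "1 - \<delta> \<le> P.prob {(w0, js). \<forall>l\<in>{1..t}. infnorm (walk w0 vs js l - w0)
          \<le> 2 * sqrt (2 * ln (real t / \<delta>) * ln (2 * (real CARD('n) * real t / \<delta>)))}" (is "_ \<le> P.prob ?A")
  proof (rule P.prob_ge_union_bound)
    \<comment> \<open>One bad event for each time and coordinate, each of probability at most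
      \<delta> / (n t).\<close>
    let ?I = "{1..t} \<times> (UNIV :: 'n set)"
    let ?bad = "\<lambda>(l, i). {(w, js). 2 * sqrt (2 * ln (real t / \<delta>) * ln (2 * (real CARD('n) * real t / \<delta>)))
      < \<bar>(walk w vs js l - w) $ i\<bar>}"
    have "?A = (\<Inter>l\<in>{1..t}. {(w0, js). infnorm (walk w0 vs js l - w0)
          \<le> 2 * sqrt (2 * ln (real t / \<delta>) * ln (2 * (real CARD('n) * real t / \<delta>)))})"
      by auto
    also have "\<dots> \<in> P.events" using assms(2) event by (intro sets.finite_INT) auto
    finally show "?A \<in> P.events" .
    show "?bad li \<in> P.events" for li by (cases li) (simp only: prod.case tail_event)
    have "1 * 1 * 1 \<le> real CARD('n) * real t * (1 / \<delta>)"
      using n t assms by (intro mult_mono) auto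
    then have one: "1 \<le> real CARD('n) * real t / \<delta>" by simp
    show "emeasure (partial_coloring \<sigma> vs) (?bad li) \<le> ennreal (1 / (real CARD('n) * real t / \<delta>))" if I: "li \<in> ?I" for li
    proof -
      obtain l i where li: "li = (l, i)" "l \<le> t" using I by (cases li) auto
      show ?thesis unfolding li(1) prod.case by (rule tail[OF li(2) one])
    qed
    show "space (partial_coloring \<sigma> vs) - ?A \<subseteq> (\<Union>li\<in>?I. ?bad li)"
      by (auto simp: infnorm_le_iff_cart not_less)
    show "real (card ?I) * (1 / (real CARD('n) * real t / \<delta>)) \<le> \<delta>"
      using t by (simp add: card_cartesian_product)
  qed (use assms in simp_all)
  moreover have "1 - \<delta> \<le> P.prob {(w0, js). infnorm (walk w0 vs js t - w0)
          \<le> 2 * sqrt (2 * ln (real t / \<delta>) * ln (2 * (real CARD('n) / \<delta>)))}" (is "_ \<le> P.prob ?B")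
  proof (rule P.prob_ge_union_bound)
    \<comment> \<open>At the final time alone there are only n bad events, so each may have
      probability \<delta> / n and the factor t leaves the logarithm.\<close>
    let ?bad = "\<lambda>i. {(w, js). 2 * sqrt (2 * ln (real t / \<delta>) * ln (2 * (real CARD('n) / \<delta>)))
      < \<bar>(walk w vs js t - w) $ i\<bar>}"
    show "?B \<in> P.events" using event by auto
    show "?bad i \<in> P.events" for i by (rule tail_event)
    have "1 * 1 \<le> real CARD('n) * (1 / \<delta>)"
      using n assms by (intro mult_mono) auto
    then have one: "1 \<le> real CARD('n) / \<delta>" by simp
    show "emeasure (partial_coloring \<sigma> vs) (?bad i) \<le> ennreal (1 / (real CARD('n) / \<delta>))" for i
      by (rule tail[OF order_refl one])
    show "space (partial_coloring \<sigma> vs) - ?B \<subseteq> (\<Union>i\<in>UNIV. ?bad i)"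
      by (auto simp: infnorm_le_iff_cart not_less)
    show "real CARD('n) * (1 / (real CARD('n) / \<delta>)) \<le> \<delta>"
      by simp
  qed (use assms in simp_all)
  moreover have "1 - \<delta> \<le> P.prob {(w0, js). \<forall>i<t. js ! i \<noteq> 0}" (is "_ \<le> P.prob ?C")
  proof (rule P.prob_ge_union_bound)
    let ?bad = "\<lambda>i. {(w, js). js ! i = 0}"
    show "?C \<in> P.events" "?bad i \<in> P.events" for i using event' by auto
    \<comment> \<open>The choice of \<sigma> makes the zero-step bound equal to the share \<delta> /
      t of each of the t steps.\<close>
    have "exp (- \<sigma>\<^sup>2) = \<delta> / real t"
      using assms t by (simp add: s2 exp_minus)
    then show "emeasure (partial_coloring \<sigma> vs) (?bad i) \<le> ennreal (\<delta> / real t)" if "i \<in> {..<t}" for i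
      using emeasure_zero_step[of i] that assms lt s2 by auto
    show "space (partial_coloring \<sigma> vs) - ?C \<subseteq> (\<Union>i\<in>{..<t}. ?bad i)" by auto
  qed (use assms t in auto)
  moreover have "2 * (real CARD('n) * real t / \<delta>) = 2 * real CARD('n) * real t / \<delta>"
    "2 * (real CARD('n) / \<delta>) = 2 * real CARD('n) / \<delta>" by simp_all
  ultimately show ?thesis by (simp only: space_partial_coloring UNIV_I simp_thms)
qed

end
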